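(* Let $T$ and $\tilde T$ be two $1$-SSA non-decreasing processes with no drift and with the same finite rate $\theta$. If $\mathrm{range}(T)$ and $\mathrm{range}(\tilde T)$ have the same distribution (as random countable subsets of $(0,\infty)$, i.e. as simple point processes on $(0,\infty)$), then there exists $c>0$ such that the processes $T$ and $c\tilde T$ have the same finite-dimensional distributions.
   Context: A stochastic process $T=(T(s),s>0)$ is $1$-self-similar additive ($1$-SSA) if (i) for all $c>0$, $(T(cs),s>0)$ and $(cT(s),s>0)$ have the same finite-dimensional distributions; and (ii) $T$ has independent increments, is stochastically continuous, has càdlàg paths, and $\lim_{s\to0+}T(s)=0$. For a non-decreasing $1$-SSA process, "no drift" means that $T(s)$ is the sum of its jumps up to time $s$. $T$ has finite rate $\theta<\infty$ if its set of jump times $\{s>0:T(s)>T(s-)\}$ is a Poisson point process on $(0,\infty)$ with intensity measure $\theta s^{-1}ds$. The range is $\mathrm{range}(T):=\{T(s):s>0\}$, regarded as a random subset of $(0,\infty)$. *)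

theory Defs
  imports "HOL-Probability.Probability"
begin

section \<open>Processes indexed by \<open>(0,\<infinity>)\<close>\<close>

text \<open>A process is a family \<open>T :: real \<Rightarrow> 'a \<Rightarrow> real\<close> of which only the members \<open>T s\<close> with
  \<open>s > 0\<close> matter. The two processes compared by \<open>same_fdd\<close> may live on different
  probability spaces.\<close>

definition same_fdd ::
    "'a measure \<Rightarrow> (real \<Rightarrow> 'a \<Rightarrow> real) \<Rightarrow> 'b measure \<Rightarrow> (real \<Rightarrow> 'b \<Rightarrow> real) \<Rightarrow> bool" where
  "same_fdd M X N Y \<longleftrightarrow>
     (\<forall>J. finite J \<and> J \<subseteq> {0<..} \<longrightarrow>
        distr M (Pi\<^sub>M J (\<lambda>_. borel)) (\<lambda>\<omega>. \<lambda>s\<in>J. X s \<omega>) =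
        distr N (Pi\<^sub>M J (\<lambda>_. borel)) (\<lambda>\<omega>. \<lambda>s\<in>J. Y s \<omega>))"

text \<open>The family of increments over \<open>0 < t 0 < \<dots> < t n\<close> includes \<open>T (t 0)\<close>, the increment from
  time \<open>0\<close>; this is the usual convention for additive processes, where \<open>T\<close> vanishes at \<open>0+\<close>.\<close>

definition indep_increments :: "'a measure \<Rightarrow> (real \<Rightarrow> 'a \<Rightarrow> real) \<Rightarrow> bool" where
  "indep_increments M T \<longleftrightarrow>
     (\<forall>(n::nat) t. 0 < t 0 \<and> strict_mono_on {..n} t \<longrightarrow>
        prob_space.indep_vars M (\<lambda>_. borel)
          (\<lambda>i \<omega>. if i = 0 then T (t 0) \<omega> else T (t i) \<omega> - T (t (i - 1)) \<omega>) {..n})"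

definition stochastically_continuous :: "'a measure \<Rightarrow> (real \<Rightarrow> 'a \<Rightarrow> real) \<Rightarrow> bool" where
  "stochastically_continuous M T \<longleftrightarrow>
     (\<forall>s>0. \<forall>\<epsilon>>0.
        ((\<lambda>u. measure M {\<omega> \<in> space M. \<epsilon> < \<bar>T u \<omega> - T s \<omega>\<bar>}) \<longlongrightarrow> 0) (at s))"

definition cadlag :: "(real \<Rightarrow> real) \<Rightarrow> bool" where
  "cadlag f \<longleftrightarrow>
     (\<forall>s>0. continuous (at_right s) f \<and> (\<exists>l. (f \<longlongrightarrow> l) (at_left s)))"

text \<open>Path properties, here and below, are only required almost surely.\<close>

definition ssa1 :: "'a measure \<Rightarrow> (real \<Rightarrow> 'a \<Rightarrow> real) \<Rightarrow> bool" where
  "ssa1 M T \<longleftrightarrow>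
     prob_space M \<and>
     (\<forall>s>0. T s \<in> borel_measurable M) \<and>
     (\<forall>c>0. same_fdd M (\<lambda>s. T (c * s)) M (\<lambda>s \<omega>. c * T s \<omega>)) \<and>
     indep_increments M T \<and>
     stochastically_continuous M T \<and>
     (AE \<omega> in M. cadlag (\<lambda>s. T s \<omega>)) \<and>
     (AE \<omega> in M. ((\<lambda>s. T s \<omega>) \<longlongrightarrow> 0) (at_right 0))"

definition nondecreasing_process :: "'a measure \<Rightarrow> (real \<Rightarrow> 'a \<Rightarrow> real) \<Rightarrow> bool" where
  "nondecreasing_process M T \<longleftrightarrow> (AE \<omega> in M. mono_on {0<..} (\<lambda>s. T s \<omega>))"


section \<open>Jumps\<close>

definition left_lim :: "(real \<Rightarrow> real) \<Rightarrow> real \<Rightarrow> real" where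
  "left_lim f s = Lim (at_left s) f"

definition jump_times :: "(real \<Rightarrow> real) \<Rightarrow> real set" where
  "jump_times f = {s. 0 < s \<and> left_lim f s < f s}"

definition no_drift :: "'a measure \<Rightarrow> (real \<Rightarrow> 'a \<Rightarrow> real) \<Rightarrow> bool" where
  "no_drift M T \<longleftrightarrow>
     (AE \<omega> in M. \<forall>s>0.
        ((\<lambda>u. T u \<omega> - left_lim (\<lambda>r. T r \<omega>) u) has_sum T s \<omega>)
          {u \<in> jump_times (\<lambda>r. T r \<omega>). u \<le> s})"


section \<open>Simple point processes on \<open>(0,\<infinity>)\<close>\<close>

text \<open>A simple point process is identified with the random set of its points. Sets of points carry
  the \<open>\<sigma>\<close>-algebra generated by the counts \<open>S \<mapsto> #(S \<inter> B)\<close>, \<open>B\<close> Borel.\<close>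

definition num_points :: "real set \<Rightarrow> real set \<Rightarrow> ennreal" where
  "num_points B S = emeasure (count_space UNIV) (S \<inter> B)"

definition point_sets :: "real set measure" where
  "point_sets = (SUP B \<in> sets borel. vimage_algebra (Pow {0<..}) (num_points B) borel)"

text \<open>The Poisson weights are written out because \<open>poisson_pmf\<close> is unspecified for mean \<open>0\<close>.\<close>

definition poisson_point_process ::
    "'a measure \<Rightarrow> real measure \<Rightarrow> ('a \<Rightarrow> real set) \<Rightarrow> bool" where
  "poisson_point_process M \<mu> X \<longleftrightarrow>
     X \<in> measurable M point_sets \<and>
     (\<forall>B \<in> sets borel. emeasure \<mu> B < \<infinity> \<longrightarrow>
        (\<forall>k::nat. measure M {\<omega> \<in> space M. num_points B (X \<omega>) = of_nat k} =
           measure \<mu> B ^ k / fact k * exp (- measure \<mu> B))) \<and>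
     (\<forall>B \<in> sets borel. emeasure \<mu> B = \<infinity> \<longrightarrow>
        (AE \<omega> in M. num_points B (X \<omega>) = \<infinity>)) \<and>
     (\<forall>B :: nat \<Rightarrow> real set. range B \<subseteq> sets borel \<and> disjoint_family B \<longrightarrow>
        prob_space.indep_vars M (\<lambda>_. borel) (\<lambda>i \<omega>. num_points (B i) (X \<omega>)) UNIV)"

text \<open>Since paths are regular only almost surely, the jump times and the range are random sets up
  to null sets: their counts are measurable for the completion of \<open>M\<close>, which assigns the same
  probabilities as \<open>M\<close> to the events of \<open>M\<close>.\<close>

definition finite_rate :: "'a measure \<Rightarrow> (real \<Rightarrow> 'a \<Rightarrow> real) \<Rightarrow> real \<Rightarrow> bool" where
  "finite_rate M T \<theta> \<longleftrightarrow>
     poisson_point_process (completion M)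
       (density lborel (\<lambda>s. ennreal (\<theta> / s) * indicator {0<..} s))
       (\<lambda>\<omega>. jump_times (\<lambda>s. T s \<omega>))"

text \<open>The intersection with \<open>(0,\<infinity>)\<close> discards at most the value \<open>0\<close> for a non-decreasing
  process vanishing at \<open>0+\<close>; if the rate is positive, that value is almost surely not attained.\<close>

definition process_range :: "(real \<Rightarrow> 'a \<Rightarrow> real) \<Rightarrow> 'a \<Rightarrow> real set" where
  "process_range T \<omega> = (\<lambda>s. T s \<omega>) ` {0<..} \<inter> {0<..}"

definition range_law :: "'a measure \<Rightarrow> (real \<Rightarrow> 'a \<Rightarrow> real) \<Rightarrow> real set measure" where
  "range_law M T = distr (completion M) point_sets (process_range T)"

end

theory Submission
  imports Defs
begin

text \<open>Sample \<open>T\<close> on the geometric grid \<open>exp (h * k)\<close>, \<open>k\<close> an integer. By self-similarity and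
  independence of increments, the increments divided by the left end of their grid interval are
  i.i.d. and vanish with probability \<open>exp (- \<theta> * h)\<close>; this persists after the first grid point at
  which \<open>T\<close> exceeds \<open>1\<close>. As \<open>h\<close> tends to \<open>0\<close>, the nonzero increments after that point become
  the gaps \<open>X\<^sub>1, X\<^sub>2, \<dots>\<close> between successive points of the range beyond \<open>1\<close>. Hence, with \<open>Y\<close> the
  size of a jump relative to its time and \<open>\<psi>\<close> the characteristic function of \<open>ln Y\<close>, the joint
  characteristic function of the logarithms of \<open>X\<^sub>2 / X\<^sub>1, X\<^sub>3 / X\<^sub>2, \<dots>\<close> at \<open>(a\<^sub>1, \<dots>, a\<^sub>n)\<close> is
  \<open>\<psi> (- a\<^sub>1) * \<psi> (a\<^sub>1 - a\<^sub>2) * \<dots> * \<psi> a\<^sub>n\<close> times the factors \<open>\<theta> / (\<theta> - \<i> * a\<^sub>j)\<close> coming from the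
  exponential logarithmic waiting times. So the law of the range determines
  \<open>\<psi> (n * d) * \<psi> (- d) ^ n\<close> for all \<open>n\<close> and \<open>d\<close>, and therefore \<open>\<psi>\<close> up to a factor
  \<open>exp (\<i> * \<gamma> * b)\<close>, that is, the law of \<open>Y\<close> up to a constant factor \<open>c\<close>. That law and \<open>\<theta>\<close>
  determine the laws of the increments of \<open>T\<close>, again by refining the grid.\<close>

section \<open>Sequences of independent increments\<close>

text \<open>The range records values but not the times at which they are reached. A gap is its jump
  time multiplied by a copy of \<open>Y\<close>, so in the quotient of successive gaps the unknown
  time survives only as a ratio of jump times, whose law depends on \<theta> alone. Its transform
  never vanishes and is the same for both processes, so it cancels; what remains are ratios of
  independent copies of \<open>Y\<close>, which cannot see a common factor, whence \<open>c\<close>.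
  Since \<psi> may have zeros, products of its values cannot be turned into sums of logarithms; the
  frequencies are chosen so that the only divisor is \<psi> at a small argument, where it is close
  to 1. The jump that leads above 1 is discarded because it is selected by its size, whereas the
  jumps after it are unbiased. The grid stands in for the strong Markov property at jump times: for
  fixed \<open>h\<close> everything concerns one i.i.d. sequence and the formulas are exact; only
  expectations of bounded functions pass to the limit.\<close>

lemma (in prob_space) integral_stream_space:
  fixes f :: "'a stream \<Rightarrow> complex"
  assumes f[measurable]: "f \<in> borel_measurable (stream_space M)"
    and bound: "\<And>s. norm (f s) \<le> B"
  shows "(\<integral>s. f s \<partial>stream_space M) = (\<integral>x. (\<integral>s. f (x ## s) \<partial>stream_space M) \<partial>M)"
proof -
  interpret S: prob_space "stream_space M"
    by (rule prob_space_stream_space)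
  interpret P: pair_prob_space M "stream_space M" ..
  let ?c = "\<lambda>(x, s). x ## s"
  \<comment> \<open>Prepending an independent head reproduces the stream measure. With this
    pushforward the claim is Fubini on the product, the bound \<open>B\<close> giving
    integrability.\<close>
  have eq: "stream_space M = distr (M \<Otimes>\<^sub>M stream_space M) (stream_space M) ?c"
  proof (rule measure_eqI)
    fix A assume "A \<in> sets (stream_space M)"
    then have A[measurable]: "A \<in> sets (stream_space M)" .
    have "emeasure (stream_space M) A = (\<integral>\<^sup>+x. (\<integral>\<^sup>+s. indicator A (x ## s) \<partial>stream_space M) \<partial>M)"
      using nn_integral_stream_space[of "indicator A"] by simp
    also have "\<dots> = (\<integral>\<^sup>+p. indicator A (?c p) \<partial>(M \<Otimes>\<^sub>M stream_space M))"
      by (subst S.nn_integral_fst[symmetric]) auto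
    also have "\<dots> = emeasure (distr (M \<Otimes>\<^sub>M stream_space M) (stream_space M) ?c) A"
      by (simp add: nn_integral_distr flip: nn_integral_indicator)
    finally show "emeasure (stream_space M) A
      = emeasure (distr (M \<Otimes>\<^sub>M stream_space M) (stream_space M) ?c) A" .
  qed simp
  have "(\<integral>s. f s \<partial>stream_space M) = (\<integral>p. f (?c p) \<partial>(M \<Otimes>\<^sub>M stream_space M))"
    by (subst eq, subst integral_distr) auto
  also have "\<dots> = (\<integral>x. (\<integral>s. f (x ## s) \<partial>stream_space M) \<partial>M)"
    by (subst P.integral_fst'[symmetric])
       (auto intro!: P.integrable_const_bound[of _ B] simp: bound split_beta)
  finally show ?thesis .
qed

section \<open>The first nonzero entry of an i.i.d. sequence\<close>

definition first_nz :: "real stream \<Rightarrow> nat" where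
  "first_nz s = (LEAST i. s !! i \<noteq> 0)"

lemma measurable_first_nz [measurable]:
  "first_nz \<in> measurable (stream_space borel) (count_space UNIV)"
  unfolding first_nz_def by measurable

lemma measurable_pred_nz [measurable]:
  "Measurable.pred (stream_space borel) (\<lambda>s :: real stream. \<exists>i. s !! i \<noteq> 0)"
  by measurable

lemma measurable_snth_first_nz [measurable]:
  "(\<lambda>s. s !! first_nz s) \<in> borel_measurable (stream_space borel)"
  by (rule measurable_compose_countable[where f="\<lambda>i s. s !! i" and g=first_nz]) auto

lemma measurable_sdrop_first_nz [measurable]:
  "(\<lambda>s. sdrop (Suc (first_nz s)) s) \<in> measurable (stream_space borel) (stream_space borel)"
  by (rule measurable_compose_countable[where f="\<lambda>i. sdrop (Suc i)" and g=first_nz]) auto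

lemma first_nz_zero: "\<exists>i. s !! i \<noteq> 0 \<Longrightarrow> first_nz (0 ## s) = Suc (first_nz s)"
  unfolding first_nz_def using Least_Suc[of "\<lambda>i. (0 ## s) !! i \<noteq> 0" "Suc i" for i] by auto

lemma first_nz_nonzero: "z \<noteq> 0 \<Longrightarrow> first_nz (z ## s) = 0"
  unfolding first_nz_def by (rule Least_equality) auto

text \<open>The exponent counts the nonzero entry as well as the zeros before it, so that
  \<open>w = cis (a * h)\<close> measures the logarithmic distance between two grid intervals. The
  value 0 on the zero sequence keeps the recursion for a zero head free of exceptions.\<close>

definition at_first_nz ::
    "complex \<Rightarrow> (real \<Rightarrow> real stream \<Rightarrow> complex) \<Rightarrow> real stream \<Rightarrow> complex" where
  "at_first_nz w F s = (if \<exists>i. s !! i \<noteq> 0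
     then w ^ Suc (first_nz s) * F (s !! first_nz s) (sdrop (Suc (first_nz s)) s) else 0)"

lemma measurable_at_first_nz:
  assumes [measurable]: "case_prod F \<in> borel_measurable (borel \<Otimes>\<^sub>M stream_space borel)"
  shows "at_first_nz w F \<in> borel_measurable (stream_space borel)"
proof -
  have [measurable]: "(\<lambda>s. F (s !! first_nz s) (sdrop (Suc (first_nz s)) s))
    \<in> borel_measurable (stream_space borel)"
    using measurable_compose[OF measurable_Pair[OF measurable_snth_first_nz measurable_sdrop_first_nz] assms]
    by simp
  show ?thesis
    unfolding at_first_nz_def[abs_def] by measurable
qed

lemma at_first_nz_zero: "at_first_nz w F (0 ## s) = w * at_first_nz w F s"
proof (cases "\<exists>i. s !! i \<noteq> 0")
  case True
  moreover from this have "\<exists>i. (0 ## s) !! i \<noteq> 0"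
    by (metis snth_Stream)
  ultimately show ?thesis
    by (simp add: at_first_nz_def first_nz_zero)
next
  case False
  then have "\<not> (\<exists>i. (0 ## s) !! i \<noteq> 0)"
    by (metis not0_implies_Suc snth.simps(1) snth_Stream stream.sel(1))
  with False show ?thesis
    by (simp add: at_first_nz_def)
qed

lemma at_first_nz_nonzero: "z \<noteq> 0 \<Longrightarrow> at_first_nz w F (z ## s) = w * F z s"
proof -
  assume "z \<noteq> 0"
  moreover from this have "\<exists>i. (z ## s) !! i \<noteq> 0"
    by (metis snth.simps(1) stream.sel(1))
  ultimately show ?thesis
    by (simp add: at_first_nz_def first_nz_nonzero)
qed

lemma norm_at_first_nz:
  assumes "norm w \<le> 1" "\<And>z s. norm (F z s) \<le> B"
  shows "norm (at_first_nz w F s) \<le> B"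
proof -
  have "norm (w ^ n) \<le> 1" for n
    using assms(1) by (simp add: norm_power power_le_one)
  then have "norm (w ^ n * F z s) \<le> 1 * B" for n z s
    unfolding norm_mult by (intro mult_mono assms) auto
  moreover have "0 \<le> B" using assms(2) norm_ge_zero order_trans by blast
  ultimately show ?thesis
    unfolding at_first_nz_def by (simp del: power_Suc sdrop.simps)
qed

context real_distribution
begin

text \<open>Conditioning on the first entry shows that the expectation \<open>E\<close> of \<open>at_first_nz w F\<close> satisfies
  \<open>E = w * (prob {0} * E + \<dots>)\<close>.\<close>

lemma integral_at_first_nz:
  assumes F: "case_prod F \<in> borel_measurable (borel \<Otimes>\<^sub>M stream_space borel)"
    and bound: "\<And>z s. norm (F z s) \<le> B" and w: "norm w \<le> 1" and q: "prob {0} < 1"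
  shows "(\<integral>s. at_first_nz w F s \<partial>stream_space M)
    = w / (1 - of_real (prob {0}) * w)
      * (\<integral>z. indicator (- {0}) z * (\<integral>s. F z s \<partial>stream_space M) \<partial>M)"
    (is "?E = _ * ?I")
proof -
  interpret S: prob_space "stream_space M"
    by (rule prob_space_stream_space)
  have sS: "sets (stream_space M) = sets (stream_space borel)"
    by (rule sets_stream_space_cong) simp
  note F[measurable]
  have [measurable]: "at_first_nz w F \<in> borel_measurable (stream_space M)"
    using measurable_at_first_nz[OF F] by (simp cong: measurable_cong_sets add: sS)
  have [measurable]: "(\<lambda>z. \<integral>s. F z s \<partial>stream_space M) \<in> borel_measurable borel"
  proof (rule S.borel_measurable_lebesgue_integral)
    show "case_prod F \<in> borel_measurable (borel \<Otimes>\<^sub>M stream_space M)"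
      using F by (simp cong: measurable_cong_sets sets_pair_measure_cong add: sS)
  qed
  have B: "0 \<le> B" using bound norm_ge_zero order_trans by blast
  have bI: "norm (\<integral>s. F z s \<partial>stream_space M) \<le> B" for z
  proof -
    have [measurable]: "F z \<in> borel_measurable (stream_space M)"
      using measurable_Pair2[OF F, of z] by (simp cong: measurable_cong_sets add: sS)
    have "norm (\<integral>s. F z s \<partial>stream_space M) \<le> (\<integral>s. norm (F z s) \<partial>stream_space M)"
      by (rule integral_norm_bound)
    also have "\<dots> \<le> B"
      by (rule S.integral_le_const) (auto intro!: S.integrable_const_bound[of _ B] simp: bound)
    finally show ?thesis .
  qed
  have step: "(\<integral>s. at_first_nz w F (z ## s) \<partial>stream_space M)
    = indicator {0} z * (w * ?E) + w * (indicator (- {0}) z * (\<integral>s. F z s \<partial>stream_space M))" for z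
    by (cases "z = 0") (simp_all add: at_first_nz_zero at_first_nz_nonzero)
  have 1: "?E = (\<integral>z. (\<integral>s. at_first_nz w F (z ## s) \<partial>stream_space M) \<partial>M)"
    by (rule integral_stream_space[of _ B]) (auto intro: norm_at_first_nz w bound)
  have 2: "(\<integral>z. (\<integral>s. at_first_nz w F (z ## s) \<partial>stream_space M) \<partial>M)
    = (\<integral>z. indicator {0} z * (w * ?E) \<partial>M)
      + (\<integral>z. w * (indicator (- {0}) z * (\<integral>s. F z s \<partial>stream_space M)) \<partial>M)"
    unfolding step
  proof (rule Bochner_Integration.integral_add)
    show "integrable M (\<lambda>z. indicator {0} z * (w * ?E))"
      by (rule integrable_const_bound[of _ "norm (w * ?E)"]) (auto simp: indicator_def)
    show "integrable M (\<lambda>z. w * (indicator (- {0}) z * (\<integral>s. F z s \<partial>stream_space M)))"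
      by (intro integrable_mult_right integrable_const_bound[of _ B])
        (auto simp: indicator_def bI B)
  qed
  have 3: "(\<integral>z. indicator {0} z * (w * ?E) \<partial>M)
      + (\<integral>z. w * (indicator (- {0}) z * (\<integral>s. F z s \<partial>stream_space M)) \<partial>M)
    = of_real (prob {0}) * (w * ?E) + w * ?I"
  proof -
    have "(\<integral>z. indicator {0} z \<partial>M) = (\<integral>z. complex_of_real (indicator {0} z) \<partial>M)"
      by (intro Bochner_Integration.integral_cong) (auto simp: indicator_def)
    also have "\<dots> = of_real (\<integral>z. indicator {0} z \<partial>M)"
      by (rule integral_complex_of_real)
    finally have "(\<integral>z. indicator {0} z \<partial>M) = (of_real (prob {0}) :: complex)"
      by simp
    then show ?thesis by (simp add: integral_mult_left_zero)
  qed
  have "E * (1 - p * w) = w * I" if "E = p * (w * E) + w * I" for E p I :: complex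
    using that by (simp add: algebra_simps)
  from this[OF trans[OF 1 trans[OF 2 3]]]
  have eq: "?E * (1 - of_real (prob {0}) * w) = w * ?I" .
  \<comment> \<open>Since \<open>prob {0} < 1\<close>, the factor \<open>1 - prob {0} * w\<close>
    cannot vanish and the equation for the expectation can be solved.\<close>
  have "norm (of_real (prob {0}) * w) \<le> prob {0} * 1"
    unfolding norm_mult by (intro mult_mono w) auto
  with q have "norm (of_real (prob {0}) * w) < 1"
    by simp
  then have "of_real (prob {0}) * w \<noteq> (1::complex)"
    by auto
  then have "1 - of_real (prob {0}) * w \<noteq> (0::complex)"
    by simp
  moreover have "E = w / d * I" if "d \<noteq> 0" "E * d = w * I" for E d I :: complex
    using that by (simp add: field_simps)
  ultimately show ?thesis
    using eq by blast
qed

end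

text \<open>If \<open>s\<close> lists the increments over a geometric grid \<open>x, x e\<^sup>h, x e\<^sup>2\<^sup>h, \<dots>\<close>, each
  divided by the left end of its interval, then an entry at distance \<open>Suc n\<close> from an earlier one
  has to be multiplied by \<open>exp (h * Suc n)\<close> before the two increments can be compared.\<close>

primrec gap_phase :: "real \<Rightarrow> real list \<Rightarrow> real \<Rightarrow> real stream \<Rightarrow> complex" where
  "gap_phase h [] y s = 1"
| "gap_phase h (a # as) y s = (if \<exists>i. s !! i \<noteq> 0
     then cis (a * (h * real (Suc (first_nz s)) + ln (s !! first_nz s) - ln y))
        * gap_phase h as (s !! first_nz s) (sdrop (Suc (first_nz s)) s) else 0)"

lemma measurable_cis [measurable]: "cis \<in> borel_measurable borel"
  by (intro borel_measurable_continuous_onI continuous_intros)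

lemma norm_gap_phase: "norm (gap_phase h as y s) \<le> 1"
  by (induction as arbitrary: y s) (auto simp: norm_mult)

text \<open>The distance enters the phase linearly, hence as a power of \<open>cis (a * h)\<close>;
  the recursion over gaps thereby becomes an instance of the first-entry formula.\<close>

lemma gap_phase_Cons:
  "gap_phase h (a # as) y
    = at_first_nz (cis (a * h)) (\<lambda>z s. cis (a * (ln z - ln y)) * gap_phase h as z s)"
proof (rule ext)
  fix s
  have "cis (a * (h * real (Suc n) + z - x)) = cis (a * h) ^ Suc n * cis (a * (z - x))" for n z x
  proof -
    have "a * (h * real (Suc n) + z - x) = real (Suc n) * (a * h) + a * (z - x)"
      by (simp add: algebra_simps)
    then show ?thesis
      unfolding Complex.DeMoivre cis_mult by (rule arg_cong)
  qed
  then show "gap_phase h (a # as) y s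
    = at_first_nz (cis (a * h)) (\<lambda>z s. cis (a * (ln z - ln y)) * gap_phase h as z s) s"
    unfolding at_first_nz_def gap_phase.simps by (simp only: mult.assoc)
qed

lemma measurable_gap_phase:
  "case_prod (gap_phase h as) \<in> borel_measurable (borel \<Otimes>\<^sub>M stream_space borel)"
proof (induction as)
  case (Cons a as)
  note Cons.IH[measurable]
  have [measurable]: "(\<lambda>p. gap_phase h as (snd p !! first_nz (snd p))
        (sdrop (Suc (first_nz (snd p))) (snd p))) 
      \<in> borel_measurable (borel \<Otimes>\<^sub>M stream_space borel :: (real \<times> real stream) measure)"
    using measurable_compose[OF measurable_compose[OF measurable_snd
        measurable_Pair[OF measurable_snth_first_nz measurable_sdrop_first_nz]] Cons.IH]
    by simp
  show ?case
    unfolding gap_phase.simps split_beta by measurable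
qed simp

text \<open>The last gap is the denominator of no ratio, so the exponent missing there counts as
  0.\<close>

definition hd0 :: "real list \<Rightarrow> real" where
  "hd0 as = (case as of [] \<Rightarrow> 0 | a # _ \<Rightarrow> a)"

lemma hd0_simps [simp]: "hd0 [] = 0" "hd0 (a # as) = a"
  by (simp_all add: hd0_def)

text \<open>With \<open>w = cis (a * h)\<close>, the fraction
  \<open>(1 - q) * w / (1 - q * w)\<close> is the generating function of a geometric waiting time
  with values from 1 on and success probability \<open>1 - q\<close>; \<open>f\<close> stands for
  the characteristic function of the logarithm of a nonzero entry.\<close>

primrec phase_weight :: "real \<Rightarrow> real \<Rightarrow> (real \<Rightarrow> complex) \<Rightarrow> real list \<Rightarrow> complex" where
  "phase_weight q h f [] = 1"
| "phase_weight q h f (a # as)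
    = (1 - of_real q) * cis (a * h) / (1 - of_real q * cis (a * h)) * f (a - hd0 as)
      * phase_weight q h f as"

text \<open>Each entry \<open>z\<close> belongs to two ratios, as numerator with exponent
  \<open>a\<close> and as denominator with exponent \<open>hd0 as\<close>; together they give
  \<open>cis ((a - hd0 as) * ln z)\<close>, while the waiting time splits off as an independent
  factor. In the induction \<open>z\<close> takes the place of the previous entry \<open>y\<close>,
  which is therefore arbitrary.\<close>

lemma (in real_distribution) integral_gap_phase:
  assumes q: "prob {0} < 1"
    and f: "\<And>b. f b = (\<integral>z. indicator (- {0}) z * cis (b * ln z) \<partial>M) / (1 - of_real (prob {0}))"
  shows "(\<integral>s. gap_phase h as y s \<partial>stream_space M)
    = cis (- hd0 as * ln y) * phase_weight (prob {0}) h f as"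
proof (induction as arbitrary: y)
  case Nil
  interpret S: prob_space "stream_space M"
    by (rule prob_space_stream_space)
  show ?case by (simp add: S.prob_space)
next
  case (Cons a as)
  note measurable_gap_phase[measurable]
  let ?w = "phase_weight (prob {0}) h f as"
  have "(\<integral>s. gap_phase h (a # as) y s \<partial>stream_space M) = cis (a * h) / (1 - of_real (prob {0}) * cis (a * h))
      * (\<integral>z. indicator (- {0}) z *
          (\<integral>s. cis (a * (ln z - ln y)) * gap_phase h as z s \<partial>stream_space M) \<partial>M)"
    unfolding gap_phase_Cons
  proof (rule integral_at_first_nz[where B=1])
    have "(\<lambda>p. cis (a * (ln (fst p) - ln y)) * case_prod (gap_phase h as) p)
      \<in> borel_measurable (borel \<Otimes>\<^sub>M stream_space borel)"
      by measurable
    then show "(\<lambda>(z, s). cis (a * (ln z - ln y)) * gap_phase h as z s)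
      \<in> borel_measurable (borel \<Otimes>\<^sub>M stream_space borel)"
      by (simp add: split_beta)
  qed (simp_all add: norm_mult norm_gap_phase q)
  also have "(\<integral>z. indicator (- {0}) z *
          (\<integral>s. cis (a * (ln z - ln y)) * gap_phase h as z s \<partial>stream_space M) \<partial>M)
      = (\<integral>z. (cis (- a * ln y) * ?w) * (indicator (- {0}) z * cis ((a - hd0 as) * ln z)) \<partial>M)"
  proof (intro Bochner_Integration.integral_cong refl)
    fix z
    have "cis (a * (ln z - ln y)) * cis (- hd0 as * ln z)
        = cis (- a * ln y) * cis ((a - hd0 as) * ln z)"
      unfolding cis_mult by (simp add: algebra_simps)
    then show "indicator (- {0}) z *
          (\<integral>s. cis (a * (ln z - ln y)) * gap_phase h as z s \<partial>stream_space M)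
      = (cis (- a * ln y) * ?w) * (indicator (- {0}) z * cis ((a - hd0 as) * ln z))"
      by (simp add: Cons.IH)
  qed
  also have "\<dots> = (cis (- a * ln y) * ?w) * ((1 - of_real (prob {0})) * f (a - hd0 as))"
    using q by (simp add: f)
  finally show ?case by simp
qed

section \<open>Paths sampled on a geometric grid\<close>

text \<open>The deterministic facts behind the pathwise arguments. Finiteness is asked for only from
  a positive time on because jumps accumulate at time 0, and it concerns values rather than jump
  times because the range consists of values.\<close>

definition jump_path :: "(real \<Rightarrow> real) \<Rightarrow> bool" where
  "jump_path f \<longleftrightarrow> mono_on {0<..} f \<and> (f \<longlongrightarrow> 0) (at_right 0)
     \<and> (\<forall>u>0. \<exists>v>u. \<forall>w\<in>{u..v}. f w = f u) \<and> (\<forall>s>0. \<forall>u. finite (f ` {s..u}))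
     \<and> infinite (f ` {0<..} \<inter> {1<..})"

text \<open>At positive rate the range accumulates at 0 and has no first point, so the enumeration
  starts above the threshold 1. The equation for each \<open>n\<close> rules out skipped
  points.\<close>

definition levels :: "real set \<Rightarrow> (nat \<Rightarrow> real) \<Rightarrow> bool" where
  "levels S z \<longleftrightarrow> strict_mono z \<and> (\<forall>n. S \<inter> {1<..z n} = z ` {..n})"

lemma levels_gt_1: "levels S z \<Longrightarrow> 1 < z n"
proof -
  assume "levels S z"
  then have "z n \<in> S \<inter> {1<..z n}" unfolding levels_def by auto
  then show "1 < z n" by auto
qed

lemma levels_in: "levels S z \<Longrightarrow> z n \<in> S"
proof -
  assume "levels S z"
  then have "z n \<in> S \<inter> {1<..z n}" unfolding levels_def by auto
  then show "z n \<in> S" by auto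
qed

lemma levels_between:
  assumes "levels S z" "y \<in> S" "z n < y" "y \<le> z (Suc n)"
  shows "y = z (Suc n)"
proof -
  have "y \<in> S \<inter> {1<..z (Suc n)}"
    using assms levels_gt_1[OF assms(1), of n] by auto
  then obtain i where i: "i \<le> Suc n" "y = z i"
    using assms(1) unfolding levels_def by auto
  moreover have "\<not> i \<le> n"
    using assms(1,3) i unfolding levels_def by (auto simp: strict_mono_less)
  ultimately show ?thesis
    by (auto elim: le_SucE)
qed

lemma levels_0:
  assumes "levels S z" "y \<in> S" "1 < y" "y \<le> z 0"
  shows "y = z 0"
proof -
  have "y \<in> S \<inter> {1<..z 0}"
    using assms by auto
  then show ?thesis
    using assms(1) unfolding levels_def by auto
qed

text \<open>By local finiteness every point, and likewise the threshold 1, has a next point above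
  it; the enumeration iterates this successor map from 1.\<close>

lemma levels_exist:
  assumes fin: "\<And>y. y \<in> S \<Longrightarrow> finite (S \<inter> {1<..y})" and inf: "infinite (S \<inter> {1<..})"
  obtains z where "levels S z"
proof -
  let ?A = "S \<inter> {1<..}"
  have least: "\<exists>y\<in>?A. x < y \<and> (\<forall>y'\<in>?A. x < y' \<longrightarrow> y \<le> y')" if x: "x \<in> insert 1 ?A" for x
  proof -
    have "finite (?A \<inter> {..x})"
    \<comment> \<open>The threshold 1 may lie outside \<open>S\<close>, where \<open>fin\<close>
      gives no information.\<close>
    proof (cases "x = 1")
      case False
      with x have "finite (S \<inter> {1<..x})" by (intro fin) auto
      then show ?thesis by (rule rev_finite_subset) auto
    next
      case True
      then have "?A \<inter> {..x} = {}" by auto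
      then show ?thesis by simp
    qed
    then have "infinite (?A - ?A \<inter> {..x})"
      using inf by (intro Diff_infinite_finite)
    then have "?A - ?A \<inter> {..x} \<noteq> {}"
      by (rule infinite_imp_nonempty)
    then have "\<exists>b. b \<in> ?A - ?A \<inter> {..x}" by blast
    then obtain b where b: "b \<in> ?A" "x < b"
      by auto
    let ?B = "{y \<in> ?A. x < y \<and> y \<le> b}"
    have f: "finite ?B"
    proof (rule finite_subset)
      show "finite (S \<inter> {1<..b})" using fin[of b] b by blast
    qed auto
    then have m: "Min ?B \<in> ?B"
      using b by (intro Min_in) auto
    have "Min ?B \<le> y'" if "y' \<in> ?A" "x < y'" for y'
    proof (cases "y' \<le> b")
      case True
      with that f show ?thesis by (intro Min_le) auto
    next
      case False
      with m show ?thesis by auto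
    qed
    with m show ?thesis
      by (intro bexI[of _ "Min ?B"]) simp_all
  qed
  define nx where "nx x = (SOME y. y \<in> ?A \<and> x < y \<and> (\<forall>y'\<in>?A. x < y' \<longrightarrow> y \<le> y'))" for x
  have nx: "nx x \<in> ?A \<and> x < nx x \<and> (\<forall>y'\<in>?A. x < y' \<longrightarrow> nx x \<le> y')" if "x \<in> insert 1 ?A" for x
    unfolding nx_def by (rule someI_ex) (use least[OF that] in blast)
  define z where "z n = (nx ^^ Suc n) 1" for n
  have zA: "z n \<in> ?A" for n
  proof (induction n)
    case 0
    have "z 0 = nx 1" by (simp add: z_def)
    with nx[of 1] show ?case by simp
  next
    case (Suc n)
    have "z (Suc n) = nx (z n)" by (simp add: z_def)
    with nx[of "z n"] Suc show ?case by simp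
  qed
  have zS: "z (Suc n) = nx (z n)" for n by (simp add: z_def)
  have mono: "strict_mono z"
    unfolding strict_mono_Suc_iff
  proof
    fix n show "z n < z (Suc n)"
      using nx[of "z n"] zA[of n] by (simp add: zS)
  qed
  have "S \<inter> {1<..z n} = z ` {..n}" for n
  proof (induction n)
    case 0
    have "z 0 = nx 1" by (simp add: z_def)
    with nx[of 1] have *: "z 0 \<in> ?A" "\<forall>y\<in>?A. z 0 \<le> y"
      by auto
    then have "S \<inter> {1<..z 0} = {z 0}"
      by (auto intro: antisym)
    then show ?case by simp
  next
    case (Suc n)
    have "S \<inter> {1<..z (Suc n)} = S \<inter> {1<..z n} \<union> {z (Suc n)}"
    proof (intro equalityI subsetI)
      fix y assume y: "y \<in> S \<inter> {1<..z (Suc n)}"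
      have "z (Suc n) \<le> y" if "z n < y"
        using nx[of "z n"] zA[of n] y that unfolding zS by simp
      with y show "y \<in> S \<inter> {1<..z n} \<union> {z (Suc n)}"
        by (cases "z n < y") auto
    next
      fix y assume "y \<in> S \<inter> {1<..z n} \<union> {z (Suc n)}"
      moreover have "z n \<le> z (Suc n)"
        using strict_mono_less_eq[OF mono, of n "Suc n"] by simp
      ultimately show "y \<in> S \<inter> {1<..z (Suc n)}"
        using zA[of "Suc n"] by auto
    qed
    then show ?case
      unfolding Suc by (simp add: atMost_Suc)
  qed
  with mono have "levels S z"
    by (simp add: levels_def)
  then show ?thesis ..
qed

text \<open>Only rational \<open>y\<close> are used, so that the infimum is countable and \<open>nth_point\<close> measurable.\<close>

definition nth_point :: "nat \<Rightarrow> real set \<Rightarrow> real" where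
  "nth_point n S = real_of_ereal
     (INF y \<in> {1<..} \<inter> \<rat>. if of_nat (Suc n) \<le> num_points {1<..y} S then ereal y else \<infinity>)"

text \<open>The count over \<open>{1<..y}\<close> reaches \<open>Suc n\<close> exactly when
  \<open>y\<close> reaches \<open>z n\<close>, and rational thresholds come arbitrarily close to
  \<open>z n\<close> from above. Levels are thus expressed through counts, hence measurably in the
  point process.\<close>

lemma nth_point_levels:
  assumes "levels S z"
  shows "nth_point n S = z n"
proof -
  have count: "of_nat (Suc n) \<le> num_points {1<..y} S \<longleftrightarrow> z n \<le> y" for y
  proof
    assume "z n \<le> y"
    then have "S \<inter> {1<..z n} \<subseteq> S \<inter> {1<..y}" by auto
    then have "z ` {..n} \<subseteq> S \<inter> {1<..y}"
      using assms unfolding levels_def by blast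
    moreover have "emeasure (count_space UNIV) (z ` {..n}) = of_nat (Suc n)"
      using assms unfolding levels_def
      by (subst emeasure_count_space_finite) (auto simp: card_image strict_mono_imp_inj_on)
    ultimately show "of_nat (Suc n) \<le> num_points {1<..y} S"
      using emeasure_mono[of "z ` {..n}" "S \<inter> {1<..y}" "count_space UNIV"]
      unfolding num_points_def by simp
  next
    assume le: "of_nat (Suc n) \<le> num_points {1<..y} S"
    show "z n \<le> y"
    proof (rule ccontr)
      assume "\<not> z n \<le> y"
      then have "S \<inter> {1<..y} \<subseteq> S \<inter> {1<..z n} - {z n}"
        by auto
      also have "\<dots> = z ` {..n} - {z n}"
        using assms unfolding levels_def by simp
      also have "\<dots> \<subseteq> z ` {..<n}"
        by (auto simp: le_less)
      finally have "num_points {1<..y} S \<le> emeasure (count_space UNIV) (z ` {..<n})"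
        unfolding num_points_def by (intro emeasure_mono) auto
      also have "\<dots> = of_nat (card (z ` {..<n}))"
        by (subst emeasure_count_space_finite) auto
      also have "\<dots> \<le> of_nat n"
        using card_image_le[of "{..<n}" z] by simp
      finally have "(of_nat (Suc n) :: ennreal) \<le> of_nat n" using le by (rule order_trans[rotated])
      then show False
        by (simp only: of_nat_le_iff)
    qed
  qed
  have "(INF y \<in> {1<..} \<inter> \<rat>. if z n \<le> y then ereal y else \<infinity>) = ereal (z n)"
  proof (rule INF_eqI)
    fix u assume u: "\<And>y. y \<in> {1<..} \<inter> \<rat> \<Longrightarrow> u \<le> (if z n \<le> y then ereal y else \<infinity>)"
    show "u \<le> ereal (z n)"
    proof (rule dense_ge)
      fix w assume "ereal (z n) < w"
      then obtain x where x: "z n < x" "ereal x < w"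
        using ereal_dense2[of "ereal (z n)" w] by auto
      obtain r where r: "r \<in> \<rat>" "z n < r" "r < x"
        using Rats_dense_in_real[OF x(1)] by auto
      have "u \<le> ereal r"
        using u[of r] r levels_gt_1[OF assms, of n] by auto
      also have "\<dots> \<le> ereal x" using r by simp
      finally show "u \<le> w" using x by simp
    qed
  qed auto
  then show ?thesis
    unfolding nth_point_def count by simp
qed

text \<open>The path is below 1 up to some time \<open>s > 0\<close>, and after time
  \<open>u\<close> it takes no value below \<open>f u\<close>. Hence all values above 1 and at most
  \<open>f u\<close> occur on \<open>{s..u}\<close>, apart from \<open>f u\<close> itself, and there
  they are finite in number.\<close>

lemma jump_path_levels:
  assumes "jump_path f"
  obtains z where "levels (f ` {0<..}) z"
proof (rule levels_exist)
  note f = assms[unfolded jump_path_def]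
  show "infinite (f ` {0<..} \<inter> {1<..})" using f by blast
  have "eventually (\<lambda>s. f s < 1) (at_right 0)"
    using f by (intro order_tendstoD) auto
  then obtain b where "0 < b" "\<And>y. 0 < y \<Longrightarrow> y < b \<Longrightarrow> f y < 1"
    unfolding eventually_at_right_field by blast
  then obtain s where s: "0 < s" "f s < 1"
    using dense by blast
  fix y assume "y \<in> f ` {0<..}"
  then obtain u where u: "0 < u" "y = f u" by auto
  have "f ` {0<..} \<inter> {1<..y} \<subseteq> f ` {s..u} \<union> {f u}"
  proof
    fix x assume "x \<in> f ` {0<..} \<inter> {1<..y}"
    then obtain r where r: "0 < r" "x = f r" "1 < f r" "f r \<le> f u"
      using u by auto
    have m: "f a \<le> f b" if "0 < a" "a \<le> b" for a b
      using f that unfolding mono_on_def by auto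
    have "s \<le> r" using m[of r s] r s by force
    moreover have "r \<le> u \<or> f r = f u" using m[of u r] r u by force
    ultimately show "x \<in> f ` {s..u} \<union> {f u}" using r by auto
  qed
  moreover have "finite (f ` {s..u} \<union> {f u})" using f s by blast
  ultimately show "finite (f ` {0<..} \<inter> {1<..y})"
    by (rule finite_subset)
qed (rule that)

section \<open>Increments of a path over a geometric grid\<close>

definition grid :: "real \<Rightarrow> int \<Rightarrow> real" where
  "grid h k = exp (h * of_int k)"

lemma grid_pos [simp]: "0 < grid h k"
  by (simp add: grid_def)

lemma grid_nonzero [simp]: "grid h k \<noteq> 0"
  by (simp add: grid_def)

lemma le_grid_iff: "0 < u \<Longrightarrow> u \<le> grid h k \<longleftrightarrow> ln u \<le> h * of_int k"
  using exp_le_cancel_iff[of "ln u" "h * of_int k"] by (simp add: grid_def)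

lemma grid_le_iff_ln: "0 < u \<Longrightarrow> grid h k \<le> u \<longleftrightarrow> h * of_int k \<le> ln u"
  using exp_le_cancel_iff[of "h * of_int k" "ln u"] by (simp add: grid_def)

lemma grid_less_iff: "0 < h \<Longrightarrow> grid h k < grid h m \<longleftrightarrow> k < m"
  by (simp add: grid_def)

lemma grid_le_iff: "0 < h \<Longrightarrow> grid h k \<le> grid h m \<longleftrightarrow> k \<le> m"
  by (simp add: grid_def)

lemma grid_add: "grid h (k + m) = grid h k * grid h m"
  by (simp add: grid_def algebra_simps exp_add)

text \<open>Division by the left end of the interval is the normalisation under which
  self-similarity makes all entries equally distributed.\<close>

definition grid_stream :: "(real \<Rightarrow> real) \<Rightarrow> real \<Rightarrow> int \<Rightarrow> real stream" where
  "grid_stream f h k = to_stream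
     (\<lambda>n. (f (grid h (k + int n + 1)) - f (grid h (k + int n))) / grid h (k + int n))"

lemma snth_grid_stream:
  "grid_stream f h k !! n = (f (grid h (k + int n + 1)) - f (grid h (k + int n))) / grid h (k + int n)"
  by (simp add: grid_stream_def to_stream_def)

lemma sdrop_grid_stream: "sdrop n (grid_stream f h k) = grid_stream f h (k + int n)"
  using smap_alt[of id "sdrop n (grid_stream f h k)" "grid_stream f h (k + int n)"]
  by (simp add: stream.map_id sdrop_snth snth_grid_stream algebra_simps)

definition crossing :: "(real \<Rightarrow> real) \<Rightarrow> real \<Rightarrow> int \<Rightarrow> bool" where
  "crossing f h k \<longleftrightarrow> f (grid h k) \<le> 1 \<and> 1 < f (grid h (k + 1))"

text \<open>The grid extends over all integers, which are not well-ordered, so a crossing is picked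
  by its least code. For a jump path the crossing is unique and the coding immaterial; searching
  through codes makes the index measurable.\<close>

definition crossing_index :: "(real \<Rightarrow> real) \<Rightarrow> real \<Rightarrow> int" where
  "crossing_index f h = from_nat (LEAST n. crossing f h (from_nat n))"

definition stream_after :: "(real \<Rightarrow> real) \<Rightarrow> real \<Rightarrow> real stream" where
  "stream_after f h = grid_stream f h (crossing_index f h + 1)"

text \<open>What \<open>gap_phase\<close> becomes once the grid is fine enough: the jump times have
  dropped out, so this is a function of the range.\<close>

primrec level_phase :: "(nat \<Rightarrow> real) \<Rightarrow> real list \<Rightarrow> real \<Rightarrow> nat \<Rightarrow> complex" where
  "level_phase z [] x j = 1"
| "level_phase z (a # as) x j = cis (a * (ln (z (Suc j) - z j) - ln x))
     * level_phase z as (z (Suc j) - z j) (Suc j)"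

context
  fixes f :: "real \<Rightarrow> real" and z :: "nat \<Rightarrow> real"
  assumes f: "jump_path f" and z: "levels (f ` {0<..}) z"
begin

lemma path_mono: "0 < a \<Longrightarrow> a \<le> b \<Longrightarrow> f a \<le> f b"
  using f unfolding jump_path_def mono_on_def by auto

lemma path_grid_mono: "0 < h \<Longrightarrow> k \<le> m \<Longrightarrow> f (grid h k) \<le> f (grid h m)"
  by (intro path_mono) (auto simp: grid_le_iff)

lemma levels_less: "z j < z (Suc j)"
  using z unfolding levels_def by (simp add: strict_mono_Suc_iff)

text \<open>Up to the first nonzero entry the path looks constant on the grid. As some grid point
  has the value \<open>z (Suc j)\<close>, the first visible change cannot overshoot this value, and
  by \<open>levels_between\<close> it cannot stop short of it.\<close>

lemma first_nz_grid_stream: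
  assumes h: "0 < h" and k: "f (grid h k) = z j" and m: "f (grid h m) = z (Suc j)"
  defines "n \<equiv> first_nz (grid_stream f h k)"
  shows "\<exists>i. grid_stream f h k !! i \<noteq> 0"
    and "f (grid h (k + int n)) = z j" "f (grid h (k + int n + 1)) = z (Suc j)"
proof -
  let ?s = "grid_stream f h k"
  have km: "k < m"
    using path_grid_mono[OF h, of m k] k m levels_less[of j] by (cases "k < m") auto
  have const: "f (grid h (k + int i)) = z j" if "\<And>i'. i' < i \<Longrightarrow> ?s !! i' = 0" for i
    using that
  proof (induction i)
    case (Suc i)
    then have "?s !! i = 0" "f (grid h (k + int i)) = z j" by auto
    then show ?case by (simp add: snth_grid_stream algebra_simps)
  qed (simp add: k)
  show ex: "\<exists>i. ?s !! i \<noteq> 0"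
  proof (rule ccontr)
    assume "\<not> (\<exists>i. ?s !! i \<noteq> 0)"
    then have "f (grid h (k + int (nat (m - k)))) = z j" by (intro const) auto
    then show False using km m levels_less[of j] by simp
  qed
  have nz: "?s !! n \<noteq> 0"
    unfolding n_def first_nz_def using ex by (rule LeastI_ex)
  have before: "?s !! i = 0" if "i < n" for i
    using not_less_Least[of i "\<lambda>i. ?s !! i \<noteq> 0"] that unfolding n_def first_nz_def by blast
  show fn: "f (grid h (k + int n)) = z j" by (rule const) (rule before)
  have "f (grid h (k + int n + 1)) \<noteq> z j"
    using nz fn by (simp add: snth_grid_stream)
  then have gt: "z j < f (grid h (k + int n + 1))"
    using path_grid_mono[OF h, of "k + int n" "k + int n + 1"] fn by simp
  have "k + int n + 1 \<le> m"
  proof (rule ccontr)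
    assume "\<not> k + int n + 1 \<le> m"
    then have "f (grid h m) \<le> f (grid h (k + int n))" using h by (intro path_grid_mono) auto
    then show False using fn m levels_less[of j] by simp
  qed
  then have "f (grid h (k + int n + 1)) \<le> z (Suc j)"
    using path_grid_mono[OF h, of "k + int n + 1" m] m by simp
  with gt show "f (grid h (k + int n + 1)) = z (Suc j)"
    by (intro levels_between[OF z]) auto
qed

text \<open>The previous gap \<open>x\<close> was completed at \<open>grid h k\<close>, so its
  normalised entry is \<open>x / grid h (k - 1)\<close>. The term \<open>h * Suc n\<close> is the
  logarithm of the ratio of the two left ends involved; the divisions cancel and ratios of gaps are
  left.\<close>

lemma gap_phase_grid_stream:
  assumes "0 < h" "0 < x" "f (grid h k) = z j"
    and "\<And>i. j < i \<Longrightarrow> i \<le> j + length as \<Longrightarrow> \<exists>m. f (grid h m) = z i"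
  shows "gap_phase h as (x / grid h (k - 1)) (grid_stream f h k) = level_phase z as x j"
  using assms
proof (induction as arbitrary: x k j)
  case (Cons a as)
  let ?s = "grid_stream f h k"
  let ?n = "first_nz ?s"
  let ?x = "z (Suc j) - z j"
  obtain m where m: "f (grid h m) = z (Suc j)"
    using Cons.prems(4)[of "Suc j"] by auto
  note * = first_nz_grid_stream[OF Cons.prems(1,3) m]
  have x: "0 < ?x" using levels_less[of j] by simp
  have v: "?s !! ?n = ?x / grid h (k + int ?n + 1 - 1)"
    using *(2,3) by (simp add: snth_grid_stream)
  have d: "sdrop (Suc ?n) ?s = grid_stream f h (k + int ?n + 1)"
    by (simp only: sdrop_grid_stream) (simp add: algebra_simps)
  have IH: "gap_phase h as (?x / grid h (k + int ?n + 1 - 1)) (grid_stream f h (k + int ?n + 1))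
    = level_phase z as ?x (Suc j)"
    using Cons.prems x *(3) by (intro Cons.IH) auto
  have "h * real (Suc ?n) + ln (?x / grid h (k + int ?n + 1 - 1)) - ln (x / grid h (k - 1))
    = ln ?x - ln x"
    using x \<open>0 < x\<close> by (simp add: ln_div grid_def algebra_simps)
  then show ?case
    using *(1) IH unfolding gap_phase.simps level_phase.simps v d by (simp only: if_True)
qed simp

text \<open>The level is held on an interval from \<open>u\<close> to \<open>v\<close>. In
  logarithmic time the grid has spacing \<open>h\<close>, so it meets this interval as soon as
  \<open>h < ln v - ln u\<close>.\<close>

lemma eventually_hits: "eventually (\<lambda>h. \<exists>m. f (grid h m) = z n) (at_right 0)"
proof -
  obtain u where u: "0 < u" "f u = z n"
    using levels_in[OF z, of n] by auto
  have "\<forall>u>0. \<exists>v>u. \<forall>w\<in>{u..v}. f w = f u"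
    using f unfolding jump_path_def by (elim conjE)
  with u obtain v where v: "u < v" "\<forall>w\<in>{u..v}. f w = z n"
    by metis
  have "ln u < ln v" using u v by simp
  then have "eventually (\<lambda>h::real. h < ln v - ln u) (at_right 0)"
    by (intro order_tendstoD) auto
  moreover have "eventually (\<lambda>h::real. 0 < h) (at_right 0)"
    by (simp add: eventually_at_right_less)
  ultimately show ?thesis
  proof eventually_elim
    case (elim h)
    obtain m :: int where "ln u / h \<le> m" "m < ln u / h + 1"
      using ceiling_correct[of "ln u / h"] by (intro that[of "\<lceil>ln u / h\<rceil>"]) linarith+
    then have "ln u \<le> h * m" "h * m < ln u + h"
      using elim by (simp_all add: field_simps)
    then have "ln u \<le> h * m" "h * m \<le> ln v" using elim by auto
    then have "u \<le> grid h m" "grid h m \<le> v"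
      using u v by (simp_all add: le_grid_iff grid_le_iff_ln)
    with v(2) have "f (grid h m) = z n" by simp
    then show ?case ..
  qed
qed

lemma crossing_exists:
  assumes h: "0 < h"
  shows "\<exists>k. crossing f h k"
proof -
  have "eventually (\<lambda>s. f s < 1) (at_right 0)"
    using f unfolding jump_path_def by (intro order_tendstoD) auto
  then obtain b where "0 < b" "\<And>y. 0 < y \<Longrightarrow> y < b \<Longrightarrow> f y < 1"
    unfolding eventually_at_right_field by blast
  then obtain s where s: "0 < s" "f s < 1"
    using dense by blast
  obtain k :: int where "k \<le> ln s / h"
    using of_int_floor_le by blast
  then have "h * k \<le> ln s" using h by (simp add: field_simps)
  then have "grid h k \<le> s" using s by (simp add: grid_le_iff_ln)
  then have k: "f (grid h k) \<le> 1" using path_mono[of "grid h k" s] s by simp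
  obtain u where u: "0 < u" "f u = z 0"
    using levels_in[OF z, of 0] by auto
  obtain m :: int where "ln u / h \<le> m"
    using le_of_int_ceiling by blast
  then have "ln u \<le> h * m" using h by (simp add: field_simps)
  then have "u \<le> grid h m" using u by (simp add: le_grid_iff)
  then have m: "1 < f (grid h m)"
    using path_mono[of u "grid h m"] u levels_gt_1[OF z, of 0] by simp
  have km: "k \<le> m"
    using path_grid_mono[OF h, of m k] k m by force
  have "\<exists>k. crossing f h k" if "1 < f (grid h m')" "k \<le> m'" for m'
    using that(2,1)
  proof (induction m' rule: int_ge_induct)
    case base
    with k show ?case by simp
  next
    case (step i)
    then show ?case by (cases "1 < f (grid h i)") (auto simp: crossing_def intro!: exI[of _ i])
  qed
  with m km show ?thesis by blast
qed

lemma crossing_unique: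
  assumes "0 < h" "crossing f h k" "crossing f h m"
  shows "k = m"
proof -
  have "\<not> k < m" if "crossing f h k" "crossing f h m" for k m
    using path_grid_mono[OF assms(1), of "k + 1" m] that by (auto simp: crossing_def)
  with assms(2,3) have "\<not> k < m" "\<not> m < k" by blast+
  then show ?thesis by simp
qed

lemma crossing_crossing_index:
  assumes "0 < h"
  shows "crossing f h (crossing_index f h)"
proof -
  have "\<exists>n. crossing f h (from_nat n)"
    using crossing_exists[OF assms] by (metis from_nat_to_nat)
  then show ?thesis
    unfolding crossing_index_def by (rule LeastI_ex)
qed

lemma crossing_iff_index: "0 < h \<Longrightarrow> crossing f h k \<longleftrightarrow> k = crossing_index f h"
  using crossing_unique crossing_crossing_index by blast

text \<open>A grid that hits \<open>z 0\<close> cannot jump past it, so the first grid value above 1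
  is the first level.\<close>

lemma stream_after_level:
  assumes "0 < h" "f (grid h m) = z 0"
  shows "f (grid h (crossing_index f h + 1)) = z 0"
proof -
  let ?k = "crossing_index f h"
  have c: "crossing f h ?k" by (rule crossing_crossing_index) fact
  have "?k + 1 \<le> m"
    using path_grid_mono[OF assms(1), of m ?k] c assms levels_gt_1[OF z, of 0]
    by (force simp: crossing_def)
  then have "f (grid h (?k + 1)) \<le> z 0"
    using path_grid_mono[OF assms(1), of "?k + 1" m] assms by simp
  with c show ?thesis
    by (intro levels_0[OF z]) (auto simp: crossing_def)
qed

lemma eventually_hits_all:
  "eventually (\<lambda>h. 0 < h \<and> (\<forall>i\<le>n. \<exists>m. f (grid h m) = z i)) (at_right 0)"
proof -
  have "eventually (\<lambda>h. \<forall>i\<in>{..n}. \<exists>m. f (grid h m) = z i) (at_right 0)"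
    by (rule eventually_ball_finite) (auto intro: eventually_hits)
  moreover have "eventually (\<lambda>h::real. 0 < h) (at_right 0)"
    by (simp add: eventually_at_right_less)
  ultimately show ?thesis
    by eventually_elim auto
qed

lemma eventually_gap_phase:
  "eventually (\<lambda>h. gap_phase h (0 # as) 1 (stream_after f h) = level_phase z (0 # as) 1 0) (at_right 0)"
  using eventually_hits_all[of "Suc (length as)"]
proof eventually_elim
  case (elim h)
  let ?k = "crossing_index f h + 1"
  have k: "f (grid h ?k) = z 0"
    using elim stream_after_level by blast
  \<comment> \<open>The exponent 0 removes any dependence on the previous entry, so a fictitious one
    is inserted to match \<open>gap_phase_grid_stream\<close> with \<open>x = 1\<close>.\<close>
  have "gap_phase h (0 # as) 1 s = gap_phase h (0 # as) y s" for y s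
    by simp
  then have "gap_phase h (0 # as) 1 (stream_after f h)
    = gap_phase h (0 # as) (1 / grid h (?k - 1)) (grid_stream f h ?k)"
    unfolding stream_after_def by blast
  also have "\<dots> = level_phase z (0 # as) 1 0"
    using elim k by (intro gap_phase_grid_stream) auto
  finally show ?case .
qed

text \<open>The first nonzero entry is \<open>z 1 - z 0\<close> divided by the left end of the grid
  interval in which \<open>z 1\<close> is first seen. This interval contains the time
  \<open>Inf U\<close> at which \<open>z 1\<close> is reached, so its left end tends to that time.
  The limit is the size of the jump relative to its time: the variable \<open>Y\<close> seen on a
  single path.\<close>

lemma first_gap_tendsto:
  obtains y where "0 < y"
    "((\<lambda>h. stream_after f h !! first_nz (stream_after f h)) \<longlongrightarrow> y) (at_right 0)"
    "eventually (\<lambda>h. \<exists>i. stream_after f h !! i \<noteq> 0) (at_right 0)"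
proof -
  define U where "U = {u. 0 < u \<and> z 1 \<le> f u}"
  obtain u0 where u0: "0 < u0" "f u0 = z 0"
    using levels_in[OF z, of 0] by auto
  obtain u1 where u1: "0 < u1" "f u1 = z 1"
    using levels_in[OF z, of 1] by auto
  have z01: "z 0 < z 1" using levels_less[of 0] by simp
  have lower: "a \<le> u" if "u \<in> U" "0 < a" "f a = z 0" for a u
    using path_mono[of u a] that z01 unfolding U_def by force
  have bdd: "bdd_below U" by (rule bdd_belowI[of _ u0]) (use lower u0 in auto)
  have U: "u1 \<in> U" using u1 by (simp add: U_def)
  let ?\<sigma> = "Inf U"
  have "u0 \<le> ?\<sigma>" using U lower u0 by (intro cInf_greatest) auto
  then have \<sigma>: "0 < ?\<sigma>" using u0 by simp
  let ?s = "stream_after f"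
  let ?k = "\<lambda>h. crossing_index f h + 1 + int (first_nz (?s h))"
  have ev: "eventually (\<lambda>h. 0 < h \<and> (\<exists>i. ?s h !! i \<noteq> 0) \<and> ?s h !! first_nz (?s h) = (z 1 - z 0) / grid h (?k h)
    \<and> grid h (?k h) \<le> ?\<sigma> \<and> ?\<sigma> \<le> grid h (?k h + 1)) (at_right 0)"
    using eventually_hits_all[of 1]
  proof eventually_elim
    case (elim h)
    then obtain m where m: "f (grid h m) = z (Suc 0)" by auto
    have "f (grid h (crossing_index f h + 1)) = z 0"
      using elim stream_after_level by blast
    note * = first_nz_grid_stream[OF _ this m, folded stream_after_def]
    have "?\<sigma> \<le> grid h (?k h + 1)"
      using *(3) elim by (intro cInf_lower bdd) (auto simp: U_def)
    moreover have "grid h (?k h) \<le> ?\<sigma>"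
      using *(2) elim U by (intro cInf_greatest lower) auto
    moreover have "?s h !! first_nz (?s h) = (z 1 - z 0) / grid h (?k h)"
      using *(2,3) elim by (simp add: stream_after_def snth_grid_stream)
    ultimately show ?case using *(1) elim by simp
  qed
  have lim: "((\<lambda>h. grid h (?k h)) \<longlongrightarrow> ?\<sigma>) (at_right 0)"
  proof (rule tendsto_sandwich)
    \<comment> \<open>The interval has logarithmic length \<open>h\<close>, so its left end is at
      least \<open>Inf U * exp (- h)\<close>.\<close>
    show "eventually (\<lambda>h. ?\<sigma> * exp (- h) \<le> grid h (?k h)) (at_right 0)"
      using ev
    proof eventually_elim
      case (elim h)
      then have "?\<sigma> * exp (- h) \<le> grid h (?k h + 1) * exp (- h)"
        by (intro mult_right_mono) auto
      also have "\<dots> = grid h (?k h)"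
        by (simp add: grid_def algebra_simps flip: exp_add)
      finally show ?case .
    qed
    show "eventually (\<lambda>h. grid h (?k h) \<le> ?\<sigma>) (at_right 0)"
      using ev by eventually_elim simp
    have "((\<lambda>h. ?\<sigma> * exp (- h)) \<longlongrightarrow> ?\<sigma> * exp (- 0)) (at_right 0)"
      by (intro tendsto_intros)
    then show "((\<lambda>h. ?\<sigma> * exp (- h)) \<longlongrightarrow> ?\<sigma>) (at_right 0)" by simp
  qed simp
  have "((\<lambda>h. (z 1 - z 0) / grid h (?k h)) \<longlongrightarrow> (z 1 - z 0) / ?\<sigma>) (at_right 0)"
    using \<sigma> by (intro tendsto_divide lim tendsto_const) auto
  then have "((\<lambda>h. ?s h !! first_nz (?s h)) \<longlongrightarrow> (z 1 - z 0) / ?\<sigma>) (at_right 0)"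
    by (rule Lim_transform_eventually) (use ev in eventually_elim, simp)
  moreover have "0 < (z 1 - z 0) / ?\<sigma>" using \<sigma> z01 by simp
  moreover have "eventually (\<lambda>h. \<exists>i. ?s h !! i \<noteq> 0) (at_right 0)"
    using ev by eventually_elim simp
  ultimately show ?thesis by (intro that) auto
qed

end

section \<open>Self-similar additive processes of finite rate\<close>

text \<open>Without drift a path is the sum of its jumps, hence constant over intervals free of jump
  times; at a jump time the left limit already bounds all earlier values, so there it does increase.
  The remaining properties rest on local finiteness of the jump times.\<close>

lemma jump_path_intro:
  assumes cad: "cadlag f" and mono: "mono_on {0<..} f" and lim: "(f \<longlongrightarrow> 0) (at_right 0)"
    and jumps: "\<And>s. 0 < s \<Longrightarrow>
      ((\<lambda>u. f u - left_lim f u) has_sum f s) {u \<in> jump_times f. u \<le> s}"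
    and fin: "\<And>s u. 0 < s \<Longrightarrow> finite (jump_times f \<inter> {s<..u})"
  shows eq_iff_no_jump: "0 < s \<Longrightarrow> s \<le> u \<Longrightarrow> f s = f u \<longleftrightarrow> jump_times f \<inter> {s<..u} = {}"
    and jump_pos: "u \<in> jump_times f \<Longrightarrow> 0 < f u"
    and jump_path_if: "(\<And>s. 0 < s \<Longrightarrow> infinite (jump_times f \<inter> {s<..})) \<Longrightarrow> 0 < s \<Longrightarrow> 1 < f s
      \<Longrightarrow> jump_path f"
proof -
  let ?J = "jump_times f"
  have m: "f a \<le> f b" if "0 < a" "a \<le> b" for a b
    using mono that unfolding mono_on_def by auto
  have left: "(f \<longlongrightarrow> left_lim f u) (at_left u)" if "0 < u" for u
  proof -
    obtain l where l: "(f \<longlongrightarrow> l) (at_left u)"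
      using cad \<open>0 < u\<close> unfolding cadlag_def by blast
    then have "left_lim f u = l"
      unfolding left_lim_def by (intro tendsto_Lim) auto
    with l show ?thesis by simp
  qed
  have le_left: "f s \<le> left_lim f u" if "0 < s" "s < u" for s u
  proof (rule tendsto_lowerbound[OF left])
    have "eventually (\<lambda>w. s < w \<and> w < u) (at_left u)"
      using \<open>s < u\<close> by (simp add: eventually_at_left_field) (meson)
    then show "eventually (\<lambda>w. f s \<le> f w) (at_left u)"
      by eventually_elim (use that m in auto)
  qed (use that in auto)
  have nonneg: "0 \<le> f s" if "0 < s" for s
  proof (rule tendsto_upperbound[OF lim])
    have "eventually (\<lambda>w. 0 < w \<and> w < s) (at_right 0)"
      using \<open>0 < s\<close> by (simp add: eventually_at_right_field) (meson)
    then show "eventually (\<lambda>w. f w \<le> f s) (at_right 0)"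
      by eventually_elim (use m in auto)
  qed auto
  have strict: "f s < f u" if "u \<in> ?J" "0 < s" "s < u" for s u
    using le_left[of s u] that unfolding jump_times_def by auto
  show pos: "0 < f u" if "u \<in> ?J" for u
  proof -
    have "0 < u" using that by (simp add: jump_times_def)
    then have "f (u / 2) < f u" using that by (intro strict) auto
    with nonneg[of "u / 2"] \<open>0 < u\<close> show ?thesis by simp
  qed
  have noj: "f s = f u" if "0 < s" "s \<le> u" "?J \<inter> {s<..u} = {}" for s u
  proof -
    have "{v \<in> ?J. v \<le> u} = {v \<in> ?J. v \<le> s}"
      using that by force
    then show ?thesis
      using jumps[of s] jumps[of u] that has_sum_unique by fastforce
  qed
  show iff: "f s = f u \<longleftrightarrow> ?J \<inter> {s<..u} = {}" if "0 < s" "s \<le> u" for s u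
  proof
    assume eq: "f s = f u"
    show "?J \<inter> {s<..u} = {}"
    proof (rule ccontr)
      assume "?J \<inter> {s<..u} \<noteq> {}"
      then obtain v where "v \<in> ?J" "s < v" "v \<le> u" by auto
      then show False using strict[of v s] m[of v u] eq \<open>0 < s\<close> by auto
    qed
  qed (use that noj in blast)
  assume inf: "\<And>s. 0 < s \<Longrightarrow> infinite (?J \<inter> {s<..})" and s: "0 < s" "1 < f s"
  have "\<exists>v>u. \<forall>w\<in>{u..v}. f w = f u" if "0 < u" for u
  proof -
    have "\<exists>v>u. ?J \<inter> {u<..v} = {}"
    proof (cases "?J \<inter> {u<..u+1} = {}")
      case False
      let ?v = "Min (?J \<inter> {u<..u+1})"
      have v: "?v \<in> ?J \<inter> {u<..u+1}" using fin[OF that] False by (rule Min_in)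
      have "?v \<le> w" if "w \<in> ?J \<inter> {u<..u+1}" for w
        using fin[OF \<open>0 < u\<close>] that by (rule Min_le)
      then have "?J \<inter> {u<..(u + ?v) / 2} = {}"
        using v by force
      moreover have "u < (u + ?v) / 2" using v by simp
      ultimately show ?thesis by blast
    qed (intro exI[of _ "u+1"], simp)
    then obtain v where v: "u < v" "?J \<inter> {u<..v} = {}" by blast
    have "f w = f u" if "w \<in> {u..v}" for w
    proof -
      have "?J \<inter> {u<..w} = {}" using v that by auto
      then show ?thesis using noj[of u w] that \<open>0 < u\<close> by simp
    qed
    with v show ?thesis by blast
  qed
  moreover have "finite (f ` {a..b})" if "0 < a" for a b
  proof -
    \<comment> \<open>Each value between \<open>a\<close> and \<open>b\<close> is a sum over the
      jumps up to \<open>a\<close> and some subset of the finitely many later ones; finitely many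
      subsets give finitely many values.\<close>
    let ?G = "\<lambda>X. infsum (\<lambda>u. f u - left_lim f u) ({u \<in> ?J. u \<le> a} \<union> X)"
    have "f ` {a..b} \<subseteq> ?G ` Pow (?J \<inter> {a<..b})"
    proof
      fix y assume "y \<in> f ` {a..b}"
      then obtain w where w: "a \<le> w" "w \<le> b" "y = f w" by auto
      have "{u \<in> ?J. u \<le> w} = {u \<in> ?J. u \<le> a} \<union> (?J \<inter> {a<..w})"
        using w by auto
      then have "f w = ?G (?J \<inter> {a<..w})"
        using infsumI[OF jumps[of w]] w that by simp
      moreover have "?J \<inter> {a<..w} \<in> Pow (?J \<inter> {a<..b})" using w by auto
      ultimately show "y \<in> ?G ` Pow (?J \<inter> {a<..b})" using w by blast
    qed
    moreover have "finite (?G ` Pow (?J \<inter> {a<..b}))"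
      by (intro finite_imageI finite_Pow_iff[THEN iffD2] fin that)
    ultimately show ?thesis by (rule finite_subset)
  qed
  moreover have "infinite (f ` {0<..} \<inter> {1<..})"
  proof -
    have "inj_on f (?J \<inter> {s<..})"
    proof (rule linorder_inj_onI)
      fix x y assume "x < y" "x \<in> ?J \<inter> {s<..}" "y \<in> ?J \<inter> {s<..}"
      then show "f x \<noteq> f y" using strict[of y x] s by auto
    qed auto
    then have "infinite (f ` (?J \<inter> {s<..}))"
      using inf[OF s(1)] by (simp add: finite_image_iff)
    moreover have "f ` (?J \<inter> {s<..}) \<subseteq> f ` {0<..} \<inter> {1<..}"
    proof
      fix y assume "y \<in> f ` (?J \<inter> {s<..})"
      then obtain u where "s < u" "y = f u" by auto
      then show "y \<in> f ` {0<..} \<inter> {1<..}" using m[of s u] s by auto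
    qed
    ultimately show ?thesis by (metis finite_subset)
  qed
  ultimately show "jump_path f"
    unfolding jump_path_def using mono lim by blast
qed

section \<open>Completions, counts of points and the intensity of the jump times\<close>

lemma AE_completion_iff: "(AE x in completion M. P x) \<longleftrightarrow> (AE x in M. P x)"
proof
  assume "AE x in completion M. P x"
  then obtain A where "A \<in> null_sets (completion M)" "{x \<in> space M. \<not> P x} \<subseteq> A"
    unfolding eventually_ae_filter by auto
  moreover from this(1) obtain B where "B \<in> null_sets M" "A \<subseteq> B"
    unfolding null_sets_completion_iff2 by blast
  ultimately show "AE x in M. P x"
    by (intro AE_I'[of B]) auto
qed (rule AE_completion)

lemma measurable_num_points [measurable]:
  assumes "B \<in> sets borel"
  shows "num_points B \<in> borel_measurable point_sets"
  unfolding point_sets_def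
proof (rule measurable_Sup1)
  show "vimage_algebra (Pow {0<..}) (num_points B) borel
      \<in> (\<lambda>B. vimage_algebra (Pow {0<..}) (num_points B) borel) ` sets borel"
    using assms by (rule imageI)
  show "num_points B \<in> borel_measurable (vimage_algebra (Pow {0<..}) (num_points B) borel)"
    by (rule measurable_vimage_algebra1) simp
qed (auto simp: space_vimage_algebra)

lemma measurable_into_point_sets:
  assumes "\<And>\<omega>. \<omega> \<in> space M \<Longrightarrow> X \<omega> \<subseteq> {0<..}"
    and "\<And>B. B \<in> sets borel \<Longrightarrow> (\<lambda>\<omega>. num_points B (X \<omega>)) \<in> borel_measurable M"
  shows "X \<in> measurable M point_sets"
  unfolding point_sets_def
proof (rule measurable_Sup2)
  fix m assume "m \<in> (\<lambda>B. vimage_algebra (Pow {0<..}) (num_points B) borel) ` sets borel"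
  then obtain B where "B \<in> sets borel" "m = vimage_algebra (Pow {0<..}) (num_points B) borel"
    by blast
  then show "X \<in> measurable M m"
    using assms by (auto intro!: measurable_vimage_algebra2)
qed (auto simp: space_vimage_algebra)

lemma num_points_eq_0_iff: "num_points B S = 0 \<longleftrightarrow> S \<inter> B = {}"
  by (simp add: num_points_def emeasure_count_space_eq_0)

lemma num_points_infinite_iff: "num_points B S = \<infinity> \<longleftrightarrow> infinite (S \<inter> B)"
  unfolding num_points_def by (cases "finite (S \<inter> B)") auto

text \<open>The image of \<theta> times Lebesgue measure under the exponential function: on the
  logarithmic time axis the jumps form a homogeneous Poisson process.\<close>

definition log_intensity :: "real \<Rightarrow> real measure" where
  "log_intensity \<theta> = density lborel (\<lambda>s. ennreal (\<theta> / s) * indicator {0<..} s)"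

lemma emeasure_log_intensity:
  assumes "0 < a" "a \<le> b" "0 \<le> \<theta>"
  shows "emeasure (log_intensity \<theta>) {a<..b} = ennreal (\<theta> * ln (b / a))"
proof -
  have "emeasure (log_intensity \<theta>) {a<..b}
    = (\<integral>\<^sup>+s. ennreal (\<theta> / s) * indicator {0<..} s * indicator {a<..b} s \<partial>lborel)"
    unfolding log_intensity_def by (subst emeasure_density) auto
  also have "\<dots> = (\<integral>\<^sup>+s. ennreal (\<theta> / s) * indicator {a..b} s \<partial>lborel)"
  proof (rule nn_integral_cong_AE)
    show "AE s in lborel. ennreal (\<theta> / s) * indicator {0<..} s * indicator {a<..b} s
      = ennreal (\<theta> / s) * indicator {a..b} s"
      using AE_lborel_singleton[of a] by eventually_elim (use assms in \<open>auto simp: indicator_def\<close>)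
  qed
  also have "\<dots> = ennreal (\<theta> * ln b - \<theta> * ln a)"
    using assms by (intro nn_integral_FTC_Icc) (auto intro!: derivative_eq_intros)
  also have "\<dots> = ennreal (\<theta> * ln (b / a))"
    using assms by (simp add: ln_div algebra_simps)
  finally show ?thesis .
qed

text \<open>An interval whose ends have ratio \<open>exp n\<close> carries mass
  \<open>\<theta> * n\<close>, which is unbounded in \<open>n\<close>.\<close>

lemma emeasure_log_intensity_infinite:
  assumes "0 < \<theta>" "\<And>n. B \<supseteq> {a n<..b n}" "\<And>n. 0 < a n" "\<And>n. b n / a n = exp (real n)"
    and [measurable]: "B \<in> sets borel"
  shows "emeasure (log_intensity \<theta>) B = \<infinity>"
proof (rule ccontr)
  assume "emeasure (log_intensity \<theta>) B \<noteq> \<infinity>"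
  then obtain r where r: "emeasure (log_intensity \<theta>) B = ennreal r" "0 \<le> r"
    by (cases "emeasure (log_intensity \<theta>) B") auto
  obtain n :: nat where n: "r / \<theta> < n" using reals_Archimedean2 by blast
  have "b n = a n * exp (real n)" using assms(3,4)[of n] by (simp add: field_simps)
  then have "a n \<le> b n" using assms(3)[of n] by simp
  then have "ennreal (\<theta> * ln (b n / a n)) = emeasure (log_intensity \<theta>) {a n<..b n}"
    using assms by (intro emeasure_log_intensity[symmetric]) auto
  also have "\<dots> \<le> ennreal r"
    unfolding r(1)[symmetric] using assms(2) by (intro emeasure_mono) (auto simp: log_intensity_def)
  finally have "\<theta> * real n \<le> r" using r assms(1,4) by (simp add: ennreal_le_iff)
  with n assms(1) show False by (simp add: field_simps)
qed

lemma same_fdd_distr_eq: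
  assumes "same_fdd M X N Y" "finite J" "J \<subseteq> {0<..}"
    and X: "\<And>s. s \<in> J \<Longrightarrow> X s \<in> borel_measurable M" and Y: "\<And>s. s \<in> J \<Longrightarrow> Y s \<in> borel_measurable N"
    and g: "g \<in> measurable (Pi\<^sub>M J (\<lambda>_. borel)) L"
  shows "distr M L (\<lambda>\<omega>. g (\<lambda>s\<in>J. X s \<omega>)) = distr N L (\<lambda>\<omega>. g (\<lambda>s\<in>J. Y s \<omega>))"
proof -
  have "distr M L (\<lambda>\<omega>. g (\<lambda>s\<in>J. X s \<omega>)) = distr (distr M (Pi\<^sub>M J (\<lambda>_. borel)) (\<lambda>\<omega>. \<lambda>s\<in>J. X s \<omega>)) L g"
    by (subst distr_distr) (auto intro!: g measurable_restrict X simp: comp_def)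
  also have "\<dots> = distr (distr N (Pi\<^sub>M J (\<lambda>_. borel)) (\<lambda>\<omega>. \<lambda>s\<in>J. Y s \<omega>)) L g"
    using assms(1-3) unfolding same_fdd_def by simp
  also have "\<dots> = distr N L (\<lambda>\<omega>. g (\<lambda>s\<in>J. Y s \<omega>))"
    by (subst distr_distr) (auto intro!: g measurable_restrict Y simp: comp_def)
  finally show ?thesis .
qed

section \<open>Almost sure properties of the paths\<close>

locale no_drift_ssa = prob_space M
  for M :: "'a measure" and T :: "real \<Rightarrow> 'a \<Rightarrow> real" and \<theta> :: real +
  assumes rate_nonneg: "0 \<le> \<theta>"
    and ssa: "ssa1 M T" and nondecreasing: "nondecreasing_process M T"
    and drift: "no_drift M T" and rate: "finite_rate M T \<theta>"
begin

lemma measurable_T: "0 < s \<Longrightarrow> T s \<in> borel_measurable M"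
  using ssa by (simp add: ssa1_def)

lemma scaling: "0 < c \<Longrightarrow> same_fdd M (\<lambda>s. T (c * s)) M (\<lambda>s \<omega>. c * T s \<omega>)"
  using ssa by (simp add: ssa1_def)

lemma distr_T: "0 < c \<Longrightarrow> distr M borel (T c) = distr M borel (\<lambda>\<omega>. c * T 1 \<omega>)"
  using same_fdd_distr_eq[OF scaling, of c "{1}" "\<lambda>x. x 1" borel] measurable_T[of c] measurable_T[of 1]
  by simp

lemma distr_increment:
  assumes "0 < c" "0 < s" "0 < u"
  shows "distr M borel (\<lambda>\<omega>. T (c * u) \<omega> - T (c * s) \<omega>) = distr M borel (\<lambda>\<omega>. c * (T u \<omega> - T s \<omega>))"
proof -
  have "distr M borel (\<lambda>\<omega>. (\<lambda>v\<in>{s, u}. T (c * v) \<omega>) u - (\<lambda>v\<in>{s, u}. T (c * v) \<omega>) s)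
    = distr M borel (\<lambda>\<omega>. (\<lambda>v\<in>{s, u}. c * T v \<omega>) u - (\<lambda>v\<in>{s, u}. c * T v \<omega>) s)"
    using assms
    by (intro same_fdd_distr_eq[OF scaling, where g="\<lambda>x. x u - x s"])
      (auto intro!: borel_measurable_times borel_measurable_diff measurable_T)
  then show ?thesis by (simp add: right_diff_distrib)
qed

abbreviation "jumps \<omega> \<equiv> jump_times (\<lambda>s. T s \<omega>)"

lemma poisson: "poisson_point_process (completion M) (log_intensity \<theta>) jumps"
  using rate by (simp add: finite_rate_def log_intensity_def)

lemma measurable_num_jumps:
  "B \<in> sets borel \<Longrightarrow> (\<lambda>\<omega>. num_points B (jumps \<omega>)) \<in> borel_measurable (completion M)"
  using poisson unfolding poisson_point_process_def
  by (intro measurable_compose[OF _ measurable_num_points]) auto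

lemma prob_num_jumps:
  assumes "0 < a" "a \<le> b"
  shows "measure (completion M) {\<omega> \<in> space M. num_points {a<..b} (jumps \<omega>) = of_nat k}
    = (\<theta> * ln (b / a)) ^ k / fact k * exp (- (\<theta> * ln (b / a)))"
proof -
  have "0 \<le> \<theta> * ln (b / a)" using assms rate_nonneg by simp
  then have "measure (log_intensity \<theta>) {a<..b} = \<theta> * ln (b / a)"
    unfolding measure_def emeasure_log_intensity[OF assms rate_nonneg] by simp
  moreover have "emeasure (log_intensity \<theta>) {a<..b} < \<infinity>"
    unfolding emeasure_log_intensity[OF assms rate_nonneg] by simp
  ultimately show ?thesis
    using poisson unfolding poisson_point_process_def by simp
qed

text \<open>The Poisson weights of the finite counts add up to 1, which leaves no probability for an
  infinite count.\<close>

lemma AE_finite_jumps: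
  assumes "0 < a" "a \<le> b"
  shows "AE \<omega> in M. finite (jumps \<omega> \<inter> {a<..b})"
proof -
  interpret C: prob_space "completion M"
    by (rule prob_spaceI) (simp add: emeasure_space_1)
  let ?m = "\<theta> * ln (b / a)"
  let ?A = "\<lambda>k::nat. {\<omega> \<in> space M. num_points {a<..b} (jumps \<omega>) = of_nat k}"
  have A: "?A k \<in> sets (completion M)" for k
    using measurable_sets[OF measurable_num_jumps[of "{a<..b}"], of "{of_nat k}"]
    by (simp add: vimage_def Int_def conj_commute)
  have "(\<lambda>k. C.prob (?A k)) sums C.prob (\<Union>k. ?A k)"
    using A by (intro C.finite_measure_UNION) (auto simp: disjoint_family_on_def)
  moreover have "(\<lambda>k. ?m ^ k / fact k * exp (- ?m)) sums (exp ?m * exp (- ?m))"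
    using exp_converges[of ?m] by (intro sums_mult2) (simp add: field_simps)
  ultimately have "C.prob (\<Union>k. ?A k) = 1"
    unfolding prob_num_jumps[OF assms] by (simp add: sums_iff exp_minus)
  then have "AE \<omega> in completion M. \<omega> \<in> (\<Union>k. ?A k)"
    using A by (subst C.AE_in_set_eq_1) auto
  then have "AE \<omega> in M. \<omega> \<in> (\<Union>k. ?A k)"
    unfolding AE_completion_iff .
  then show ?thesis
  proof eventually_elim
    case (elim \<omega>)
    then have "num_points {a<..b} (jumps \<omega>) \<noteq> \<infinity>" by auto
    then show ?case unfolding num_points_infinite_iff by simp
  qed
qed

lemma AE_infinite_jumps:
  assumes "B \<in> sets borel" "emeasure (log_intensity \<theta>) B = \<infinity>"
  shows "AE \<omega> in M. infinite (jumps \<omega> \<inter> B)"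
proof -
  have "AE \<omega> in completion M. num_points B (jumps \<omega>) = \<infinity>"
    using poisson assms unfolding poisson_point_process_def by blast
  then show ?thesis
    unfolding AE_completion_iff num_points_infinite_iff .
qed

definition regular :: "(real \<Rightarrow> real) \<Rightarrow> bool" where
  "regular f \<longleftrightarrow> cadlag f \<and> mono_on {0<..} f \<and> (f \<longlongrightarrow> 0) (at_right 0)
     \<and> (\<forall>s>0. ((\<lambda>u. f u - left_lim f u) has_sum f s) {u \<in> jump_times f. u \<le> s})
     \<and> (\<forall>s u. 0 < s \<longrightarrow> finite (jump_times f \<inter> {s<..u}))"

lemma AE_regular: "AE \<omega> in M. regular (\<lambda>s. T s \<omega>)"
proof -
  \<comment> \<open>Countably many intervals exhaust the positive axis, so one null set serves all
    \<open>s\<close> and \<open>u\<close>.\<close>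
  have "AE \<omega> in M. \<forall>n. finite (jumps \<omega> \<inter> {1 / real (Suc n)<..real (Suc n)})"
    unfolding AE_all_countable by (intro allI AE_finite_jumps) (simp_all add: field_simps)
  moreover have "AE \<omega> in M. cadlag (\<lambda>s. T s \<omega>)" "AE \<omega> in M. ((\<lambda>s. T s \<omega>) \<longlongrightarrow> 0) (at_right 0)"
    using ssa by (auto simp: ssa1_def)
  moreover note nondecreasing[unfolded nondecreasing_process_def] drift[unfolded no_drift_def]
  ultimately show ?thesis
  proof eventually_elim
    case (elim \<omega>)
    have "finite (jumps \<omega> \<inter> {s<..u})" if "0 < s" for s u
    proof -
      obtain n :: nat where n: "max u (1 / s) < n" using reals_Archimedean2 by blast
      then have "1 / s < real (Suc n)" by simp
      then have "1 / real (Suc n) < s" using that by (simp add: field_simps)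
      then have "jumps \<omega> \<inter> {s<..u} \<subseteq> jumps \<omega> \<inter> {1 / real (Suc n)<..real (Suc n)}"
        using n by auto
      then show ?thesis using elim(1) finite_subset by blast
    qed
    with elim show ?case by (simp add: regular_def)
  qed
qed

text \<open>The two values agree exactly when no jump falls between the two times, which has the
  Poisson weight at 0 as its probability. Jump counts are measurable only for the completion, so the
  two events are compared there.\<close>

lemma prob_eq:
  assumes "0 < s" "s \<le> u"
  shows "prob {\<omega> \<in> space M. T u \<omega> = T s \<omega>} = exp (- (\<theta> * ln (u / s)))"
proof -
  have [measurable]: "T u \<in> borel_measurable M" "T s \<in> borel_measurable M"
    using assms measurable_T by auto
  interpret C: prob_space "completion M"
    by (rule prob_spaceI) (simp add: emeasure_space_1)
  let ?A = "{\<omega> \<in> space M. num_points {s<..u} (jumps \<omega>) = of_nat 0}"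
  have A: "?A \<in> sets (completion M)"
    using measurable_sets[OF measurable_num_jumps[of "{s<..u}"], of "{0}"]
    by (simp add: vimage_def Int_def conj_commute)
  have "prob {\<omega> \<in> space M. T u \<omega> = T s \<omega>} = measure (completion M) {\<omega> \<in> space M. T u \<omega> = T s \<omega>}"
    by (rule measure_completion[symmetric]) measurable
  also have "\<dots> = measure (completion M) ?A"
  proof (rule C.finite_measure_eq_AE)
    show "AE \<omega> in completion M. (\<omega> \<in> {\<omega> \<in> space M. T u \<omega> = T s \<omega>}) = (\<omega> \<in> ?A)"
      unfolding AE_completion_iff using AE_regular AE_space
    proof eventually_elim
      case (elim \<omega>)
      then have "T s \<omega> = T u \<omega> \<longleftrightarrow> jumps \<omega> \<inter> {s<..u} = {}"
        unfolding regular_def using assms by (intro eq_iff_no_jump) auto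
      then show ?case using elim(2) by (auto simp: num_points_eq_0_iff)
    qed
  qed (use A in auto)
  finally show ?thesis unfolding prob_num_jumps[OF assms] by simp
qed

text \<open>At rate 0 the values at any two times agree almost surely; comparing with the times
  \<open>s / Suc n\<close>, along which the path tends to 0, leaves only the value 0.\<close>

lemma T_eq_0:
  assumes "\<theta> = 0" "0 < s"
  shows "AE \<omega> in M. T s \<omega> = 0"
proof -
  have "prob {\<omega> \<in> space M. T s \<omega> = T (s / real (Suc n)) \<omega>} = 1" for n
    using prob_eq[of "s / real (Suc n)" s] assms by (simp add: field_simps)
  moreover have "{\<omega> \<in> space M. T s \<omega> = T (s / real (Suc n)) \<omega>} \<in> events" for n
  proof -
    have [measurable]: "T s \<in> borel_measurable M" "T (s / real (Suc n)) \<in> borel_measurable M"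
      using assms by (auto intro!: measurable_T)
    show ?thesis by measurable
  qed
  ultimately have "AE \<omega> in M. T s \<omega> = T (s / real (Suc n)) \<omega>" for n
    by (simp only: prob_Collect_eq_1)
  then have "AE \<omega> in M. \<forall>n. T s \<omega> = T (s / real (Suc n)) \<omega>"
    by (simp add: AE_all_countable)
  moreover note AE_regular
  ultimately show ?thesis
  proof eventually_elim
    case (elim \<omega>)
    have "(\<lambda>n. s / real (Suc n)) \<longlonglongrightarrow> 0"
      using LIMSEQ_Suc[OF lim_const_over_n[of s]] by simp
    then have "filterlim (\<lambda>n. s / real (Suc n)) (at_right 0) sequentially"
      using assms by (auto intro!: tendsto_imp_filterlim_at_right)
    then have "(\<lambda>n. T (s / real (Suc n)) \<omega>) \<longlonglongrightarrow> 0"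
      using elim(2) filterlim_compose[of "\<lambda>s. T s \<omega>"] unfolding regular_def by blast
    then have "(\<lambda>n. T s \<omega>) \<longlonglongrightarrow> 0" using elim(1) by simp
    then show ?case by (simp add: LIMSEQ_const_iff)
  qed
qed

lemma AE_jump_path:
  assumes "0 < \<theta>"
  shows "AE \<omega> in M. jump_path (\<lambda>s. T s \<omega>)"
proof -
  have [measurable]: "T s \<in> borel_measurable M" if "0 < s" for s
    using that measurable_T by auto
  have "AE \<omega> in M. infinite (jumps \<omega> \<inter> {real n<..})" for n :: nat
    using assms by (intro AE_infinite_jumps emeasure_log_intensity_infinite[where
      a="\<lambda>_. real (Suc n)" and b="\<lambda>k. real (Suc n) * exp (real k)"]) auto
  then have 1: "AE \<omega> in M. \<forall>n. infinite (jumps \<omega> \<inter> {real n<..})"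
    by (simp add: AE_all_countable)
  have "AE \<omega> in M. infinite (jumps \<omega> \<inter> {0<..1})"
  proof (intro AE_infinite_jumps emeasure_log_intensity_infinite[where
        a="\<lambda>k. exp (- real k)" and b="\<lambda>k. 1"])
    show "{exp (- real n)<..1} \<subseteq> {0<..1::real}" for n
      using exp_gt_zero[of "- real n"] by (intro subsetI) (simp del: exp_gt_zero)
    show "1 / exp (- real n) = exp (real n)" for n
      by (simp add: exp_minus inverse_eq_divide)
  qed (use assms in auto)
  then have T1: "AE \<omega> in M. 0 < T 1 \<omega>"
    using AE_regular
  proof eventually_elim
    case (elim \<omega>)
    then have "jumps \<omega> \<inter> {0<..1} \<noteq> {}" by (intro infinite_imp_nonempty)
    then obtain u where u: "u \<in> jumps \<omega>" "0 < u" "u \<le> 1" by auto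
    then have "0 < T u \<omega>" using elim(2) unfolding regular_def by (intro jump_pos) auto
    also have "T u \<omega> \<le> T 1 \<omega>" using elim(2) u unfolding regular_def mono_on_def by auto
    finally show ?case .
  qed
  \<comment> \<open>Infinitely many jumps do not by themselves push a path above 1, as their sizes
    could be summable. Self-similarity does: \<open>T (Suc n) \<le> 1\<close> is as likely as
    \<open>T 1 \<le> 1 / Suc n\<close>, and this probability tends to 0 because \<open>T 1\<close>
    is positive.\<close>
  have 2: "AE \<omega> in M. \<exists>n. 1 < T (real (Suc n)) \<omega>"
  proof -
    let ?A = "\<lambda>n. {\<omega> \<in> space M. T 1 \<omega> \<le> 1 / real (Suc n)}"
    have "decseq ?A"
      unfolding decseq_def by (auto elim!: order_trans intro!: divide_left_mono)
    then have "(\<lambda>n. prob (?A n)) \<longlonglongrightarrow> prob (\<Inter>n. ?A n)"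
      by (intro finite_Lim_measure_decseq) auto
    also have "prob (\<Inter>n. ?A n) = 0"
    proof -
      have "AE \<omega> in M. \<omega> \<notin> (\<Inter>n. ?A n)"
        using T1
      proof eventually_elim
        case (elim \<omega>)
        then obtain n where "1 / real (Suc n) < T 1 \<omega>"
          using nat_approx_posE by blast
        then show ?case by (auto simp: not_le intro!: exI[of _ n])
      qed
      then show ?thesis by (subst prob_eq_0) auto
    qed
    finally have lim: "(\<lambda>n. prob (?A n)) \<longlonglongrightarrow> 0" .
    have eq: "prob {\<omega> \<in> space M. T (real (Suc n)) \<omega> \<le> 1} = prob (?A n)" for n
    proof -
      have "prob {\<omega> \<in> space M. T (real (Suc n)) \<omega> \<le> 1} = measure (distr M borel (T (real (Suc n)))) {..1}"
        by (subst measure_distr) (auto simp: vimage_def Int_def conj_commute)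
      also have "\<dots> = measure (distr M borel (\<lambda>\<omega>. real (Suc n) * T 1 \<omega>)) {..1}"
        by (simp only: distr_T of_nat_0_less_iff zero_less_Suc)
      also have "\<dots> = prob (?A n)"
        by (subst measure_distr) (auto simp: field_simps intro!: arg_cong[where f=prob])
      finally show ?thesis .
    qed
    let ?B = "{\<omega> \<in> space M. \<forall>n. T (real (Suc n)) \<omega> \<le> 1}"
    have "prob ?B \<le> prob (?A n)" for n
      unfolding eq[symmetric] by (intro finite_measure_mono) auto
    then have "prob ?B \<le> 0"
      by (intro LIMSEQ_le_const[OF lim]) auto
    then have "prob ?B = 0" using measure_nonneg[of M ?B] by linarith
    then have "AE \<omega> in M. \<not> (\<forall>n. T (real (Suc n)) \<omega> \<le> 1)"
      by (subst (asm) prob_eq_0) (auto elim: eventually_mono)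
    then show ?thesis by (auto simp: not_le)
  qed
  show ?thesis
    using 1 2 AE_regular
  proof eventually_elim
    case (elim \<omega>)
    then obtain n where n: "1 < T (real (Suc n)) \<omega>" by blast
    have inf: "infinite (jumps \<omega> \<inter> {s<..})" if "0 < s" for s
    proof -
      obtain n :: nat where n: "s < n" using reals_Archimedean2 by blast
      then have "jumps \<omega> \<inter> {real n<..} \<subseteq> jumps \<omega> \<inter> {s<..}" by auto
      then show ?thesis using elim(1) finite_subset by blast
    qed
    show ?case
      using elim(3) n inf unfolding regular_def
      by (intro jump_path_if[of "\<lambda>s. T s \<omega>" "real (Suc n)"]) auto
  qed
qed

section \<open>Independence and common law of the grid increments\<close>

abbreviation path :: "'a \<Rightarrow> real \<Rightarrow> real" where
  "path \<omega> \<equiv> \<lambda>s. T s \<omega>"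

definition incr_law :: "real \<Rightarrow> real measure" where
  "incr_law h = distr M borel (\<lambda>\<omega>. T (exp h) \<omega> - T 1 \<omega>)"

lemma measurable_T_grid [measurable]: "T (grid h k) \<in> borel_measurable M"
  by (rule measurable_T) simp

lemma measurable_T_exp [measurable]: "T (exp h) \<in> borel_measurable M"
  by (rule measurable_T) simp

lemma measurable_T_1 [measurable]: "T 1 \<in> borel_measurable M"
  by (rule measurable_T) simp

lemma real_distribution_incr_law: "real_distribution (incr_law h)"
  unfolding incr_law_def by (rule real_distribution_distr) measurable

lemma incr_law_0: "0 \<le> h \<Longrightarrow> measure (incr_law h) {0} = exp (- (\<theta> * h))"
  using prob_eq[of 1 "exp h"] unfolding incr_law_def
  by (subst measure_distr) (auto simp: vimage_def Int_def conj_commute)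

lemma distr_scaled_increment:
  assumes "0 < c"
  shows "distr M borel (\<lambda>\<omega>. (T (c * exp h) \<omega> - T c \<omega>) / c) = incr_law h"
proof -
  have [measurable]: "T (c * exp h) \<in> borel_measurable M" "T c \<in> borel_measurable M"
    using assms by (auto intro!: measurable_T)
  have "distr M borel (\<lambda>\<omega>. (T (c * exp h) \<omega> - T c \<omega>) / c)
    = distr (distr M borel (\<lambda>\<omega>. T (c * exp h) \<omega> - T (c * 1) \<omega>)) borel (\<lambda>x. x / c)"
    by (subst distr_distr) (auto simp: comp_def)
  also have "\<dots> = distr (distr M borel (\<lambda>\<omega>. c * (T (exp h) \<omega> - T 1 \<omega>))) borel (\<lambda>x. x / c)"
    using assms by (subst distr_increment) auto
  also have "\<dots> = incr_law h"
    using assms unfolding incr_law_def by (subst distr_distr) (auto simp: comp_def)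
  finally show ?thesis .
qed

text \<open>Independence of an infinite family is a condition on finite subfamilies, each of which
  lies in an initial segment.\<close>

lemma indep_increments_UNIV:
  fixes t :: "nat \<Rightarrow> real"
  assumes "0 < t 0" "strict_mono t"
  shows "indep_vars (\<lambda>_. borel) (\<lambda>i \<omega>. if i = 0 then T (t 0) \<omega> else T (t i) \<omega> - T (t (i - 1)) \<omega>) UNIV"
    (is "indep_vars _ ?X UNIV")
proof -
  have fin: "indep_vars (\<lambda>_. borel) ?X {..n}" for n
    using ssa assms unfolding ssa1_def indep_increments_def
    by (auto simp: strict_mono_on_def strict_mono_def)
  show ?thesis
    unfolding indep_vars_def2
  proof (intro conjI ballI)
    show "?X i \<in> borel_measurable M" for i
      using fin[of i] unfolding indep_vars_def2 by blast
    show "indep_sets (\<lambda>i. {?X i -` A \<inter> space M |A. A \<in> sets borel}) UNIV"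
    proof (subst indep_sets_finite_index_sets, intro allI impI)
      fix J :: "nat set" assume "finite J"
      then have "J \<subseteq> {..Max J}" by auto
      moreover have "indep_sets (\<lambda>i. {?X i -` A \<inter> space M |A. A \<in> sets borel}) {..Max J}"
        using fin[of "Max J"] unfolding indep_vars_def2 by blast
      ultimately show "indep_sets (\<lambda>i. {?X i -` A \<inter> space M |A. A \<in> sets borel}) J"
        by (rule indep_sets_mono_index)
    qed
  qed
qed

lemma measurable_grid_stream [measurable]:
  "(\<lambda>\<omega>. grid_stream (path \<omega>) h k) \<in> measurable M (stream_space borel)"
  by (rule measurable_stream_space2) (simp add: snth_grid_stream)

lemma distr_grid_stream:
  assumes h: "0 < h"
  shows "distr M (stream_space borel) (\<lambda>\<omega>. grid_stream (path \<omega>) h k) = stream_space (incr_law h)"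
proof -
  interpret I: real_distribution "incr_law h" by (rule real_distribution_incr_law)
  define t where "t n = grid h (k + int n)" for n
  define X where "X i \<omega> = (if i = 0 then T (t 0) \<omega> else T (t i) \<omega> - T (t (i - 1)) \<omega>)" for i :: nat and \<omega>
  define Z where "Z n \<omega> = (T (grid h (k + int n + 1)) \<omega> - T (grid h (k + int n)) \<omega>) / grid h (k + int n)"
    for n \<omega>
  have [measurable]: "Z n \<in> borel_measurable M" for n unfolding Z_def by measurable
  have "indep_vars (\<lambda>_. borel) X UNIV"
    unfolding X_def by (rule indep_increments_UNIV) (auto simp: t_def strict_mono_def grid_less_iff h)
  \<comment> \<open>Index 0 carries the value \<open>T (t 0)\<close>, which is no increment over the
    grid; the singleton blocks \<open>{Suc j}\<close> drop it and shift the family by one.\<close>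
  then have "indep_vars (\<lambda>j. Pi\<^sub>M {Suc j} (\<lambda>_. borel)) (\<lambda>j \<omega>. \<lambda>i\<in>{Suc j}. X i \<omega>) UNIV"
    by (rule indep_vars_restrict) (auto simp: disjoint_family_on_def)
  then have "indep_vars (\<lambda>_. borel) (\<lambda>n \<omega>. (\<lambda>i\<in>{Suc n}. X i \<omega>) (Suc n) / t n) UNIV"
    by (rule indep_vars_compose2[where Y="\<lambda>n x. x (Suc n) / t n"]) simp
  then have "indep_vars (\<lambda>_. borel) (\<lambda>n \<omega>. X (Suc n) \<omega> / t n) UNIV"
    by simp
  also have "(\<lambda>n \<omega>. X (Suc n) \<omega> / t n) = Z"
    by (simp add: fun_eq_iff X_def Z_def t_def algebra_simps)
  finally have "distr M (Pi\<^sub>M UNIV (\<lambda>_. borel)) (\<lambda>\<omega>. \<lambda>i\<in>UNIV. Z i \<omega>) = (\<Pi>\<^sub>M i\<in>UNIV. distr M borel (Z i))"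
    by (subst (asm) indep_vars_iff_distr_eq_PiM') auto
  also have "(\<lambda>i. distr M borel (Z i)) = (\<lambda>_. incr_law h)"
  proof
    fix n
    have "grid h (k + int n + 1) = grid h (k + int n) * exp h"
      using grid_add[of h "k + int n" 1] by (simp add: grid_def)
    then show "distr M borel (Z n) = incr_law h"
      using distr_scaled_increment[of "grid h (k + int n)" h] by (simp add: Z_def[abs_def])
  qed
  finally have eq: "distr M (Pi\<^sub>M UNIV (\<lambda>_. borel)) (\<lambda>\<omega> i. Z i \<omega>) = (\<Pi>\<^sub>M i\<in>UNIV. incr_law h)"
    by (simp add: restrict_UNIV)
  have "stream_space (incr_law h) = distr (\<Pi>\<^sub>M i\<in>UNIV. incr_law h) (stream_space (incr_law h)) to_stream"
    by (rule stream_space_eq_distr)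
  also have "\<dots> = distr (\<Pi>\<^sub>M i\<in>UNIV. incr_law h) (stream_space borel) to_stream"
    by (intro distr_cong sets_stream_space_cong) simp_all
  also have "\<dots> = distr M (stream_space borel) (\<lambda>\<omega>. to_stream (\<lambda>i. Z i \<omega>))"
    unfolding eq[symmetric] by (subst distr_distr) (auto simp: comp_def intro!: measurable_PiM_single')
  also have "\<dots> = distr M (stream_space borel) (\<lambda>\<omega>. grid_stream (path \<omega>) h k)"
    by (simp add: grid_stream_def Z_def)
  finally show ?thesis ..
qed

text \<open>A crossing at \<open>k\<close> is decided by the value at \<open>grid h k\<close> and
  the next increment, the indices 0 and 1; the stream from \<open>k + 1\<close> on is built from the
  later indices. For fixed \<open>k\<close> this is plain independence.\<close>

lemma prob_crossing_stream:
  assumes h: "0 < h" and B[measurable]: "B \<in> sets (stream_space borel)"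
  shows "prob {\<omega> \<in> space M. crossing (path \<omega>) h k \<and> grid_stream (path \<omega>) h (k + 1) \<in> B}
    = prob {\<omega> \<in> space M. crossing (path \<omega>) h k} * measure (stream_space (incr_law h)) B"
proof -
  define t where "t n = grid h (k + int n)" for n
  define X where "X i \<omega> = (if i = 0 then T (t 0) \<omega> else T (t i) \<omega> - T (t (i - 1)) \<omega>)" for i :: nat and \<omega>
  have "indep_vars (\<lambda>_. borel) X UNIV"
    unfolding X_def by (rule indep_increments_UNIV) (auto simp: t_def strict_mono_def grid_less_iff h)
  then have ind: "indep_var (Pi\<^sub>M {0, 1} (\<lambda>_. borel)) (\<lambda>\<omega>. \<lambda>i\<in>{0, 1}. X i \<omega>)
      (Pi\<^sub>M {2..} (\<lambda>_. borel)) (\<lambda>\<omega>. \<lambda>i\<in>{2..}. X i \<omega>)"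
    by (rule indep_var_restrict) auto
  define C :: "(nat \<Rightarrow> real) \<Rightarrow> bool" where "C x \<longleftrightarrow> x 0 \<le> 1 \<and> 1 < x 0 + x 1" for x
  define S :: "(nat \<Rightarrow> real) \<Rightarrow> real stream" where "S x = to_stream (\<lambda>n. x (n + 2) / t (n + 1))" for x
  have C: "C \<in> measurable (Pi\<^sub>M {0, 1} (\<lambda>_. borel)) (count_space UNIV)"
    unfolding C_def[abs_def] by measurable
  have S: "S \<in> measurable (Pi\<^sub>M {2..} (\<lambda>_. borel)) (stream_space borel)"
    by (rule measurable_stream_space2) (simp add: S_def to_stream_def)
  have CX: "C (\<lambda>i\<in>{0, 1}. X i \<omega>) \<longleftrightarrow> crossing (path \<omega>) h k" for \<omega>
    by (simp add: C_def X_def t_def crossing_def)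
  have SX: "S (\<lambda>i\<in>{2..}. X i \<omega>) = grid_stream (path \<omega>) h (k + 1)" for \<omega>
    unfolding S_def grid_stream_def
    by (intro arg_cong[where f=to_stream] ext) (simp add: X_def t_def algebra_simps)
  define CA where "CA = C -` {True} \<inter> space (Pi\<^sub>M {0, 1} (\<lambda>_. borel))"
  define SB where "SB = S -` B \<inter> space (Pi\<^sub>M {2..} (\<lambda>_. borel))"
  have "CA \<in> sets (Pi\<^sub>M {0, 1} (\<lambda>_. borel))" "SB \<in> sets (Pi\<^sub>M {2..} (\<lambda>_. borel))"
    unfolding CA_def SB_def by (rule measurable_sets[OF C], simp, rule measurable_sets[OF S B])
  note eq = indep_varD[OF ind this]
  have CA: "(\<lambda>i\<in>{0, 1}. X i \<omega>) \<in> CA \<longleftrightarrow> crossing (path \<omega>) h k" for \<omega>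
    using CX[of \<omega>] by (simp add: CA_def space_PiM)
  have SB: "(\<lambda>i\<in>{2..}. X i \<omega>) \<in> SB \<longleftrightarrow> grid_stream (path \<omega>) h (k + 1) \<in> B" for \<omega>
    using SX[of \<omega>] by (simp add: SB_def space_PiM)
  have "prob {\<omega> \<in> space M. crossing (path \<omega>) h k \<and> grid_stream (path \<omega>) h (k + 1) \<in> B}
    = prob {\<omega> \<in> space M. crossing (path \<omega>) h k}
      * prob {\<omega> \<in> space M. grid_stream (path \<omega>) h (k + 1) \<in> B}"
    using eq unfolding vimage_def Int_def mem_Collect_eq mem_Times_iff fst_conv snd_conv CA SB
    by (simp add: conj_commute)
  also have "prob {\<omega> \<in> space M. grid_stream (path \<omega>) h (k + 1) \<in> B}
    = measure (stream_space (incr_law h)) B"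
    unfolding distr_grid_stream[OF h, of "k + 1", symmetric]
    by (subst measure_distr) (auto simp: vimage_def Int_def conj_commute)
  finally show ?thesis .
qed

lemma measurable_crossing [measurable]:
  "Measurable.pred M (\<lambda>\<omega>. crossing (path \<omega>) h k)"
  unfolding crossing_def by measurable

lemma measurable_crossing_index [measurable]:
  "(\<lambda>\<omega>. crossing_index (path \<omega>) h) \<in> measurable M (count_space UNIV)"
  unfolding crossing_index_def by measurable

lemma measurable_stream_after [measurable]:
  "(\<lambda>\<omega>. stream_after (path \<omega>) h) \<in> measurable M (stream_space borel)"
  unfolding stream_after_def
  by (rule measurable_compose_countable[where f="\<lambda>k \<omega>. grid_stream (path \<omega>) h (k + 1)"]) measurable

text \<open>The crossing index is a stopping time of the grid, so the increments after it are again an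
  independent sequence with the same law.\<close>

lemma distr_stream_after:
  assumes \<theta>: "0 < \<theta>" and h: "0 < h"
  shows "distr M (stream_space borel) (\<lambda>\<omega>. stream_after (path \<omega>) h) = stream_space (incr_law h)"
proof (rule measure_eqI)
  interpret I: real_distribution "incr_law h" by (rule real_distribution_incr_law)
  interpret S: prob_space "stream_space (incr_law h)" by (rule I.prob_space_stream_space)
  show "sets (distr M (stream_space borel) (\<lambda>\<omega>. stream_after (path \<omega>) h)) = sets (stream_space (incr_law h))"
    using sets_stream_space_cong[of "incr_law h" borel] by simp
  fix B assume "B \<in> sets (distr M (stream_space borel) (\<lambda>\<omega>. stream_after (path \<omega>) h))"
  then have B[measurable]: "B \<in> sets (stream_space borel)" by simp
  let ?q = "emeasure (stream_space (incr_law h)) B"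
  let ?K = "\<lambda>\<omega>. crossing_index (path \<omega>) h"
  \<comment> \<open>Uniqueness of the crossing turns the value \<open>k\<close> of the index into an
    event decided by the path up to \<open>grid h (k + 1)\<close>; the claim then follows by summing
    over the countably many \<open>k\<close>.\<close>
  have iff: "AE \<omega> in M. crossing (path \<omega>) h k \<longleftrightarrow> ?K \<omega> = k" for k
    using AE_jump_path[OF \<theta>]
  proof eventually_elim
    case (elim \<omega>)
    obtain z where "levels (path \<omega> ` {0<..}) z" using jump_path_levels[OF elim] .
    from crossing_iff_index[OF elim this h] show ?case by auto
  qed
  have *: "emeasure M {\<omega> \<in> space M. ?K \<omega> = k \<and> stream_after (path \<omega>) h \<in> B}
    = emeasure M {\<omega> \<in> space M. ?K \<omega> = k} * ?q" for k
  proof -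
    have "emeasure M {\<omega> \<in> space M. ?K \<omega> = k \<and> stream_after (path \<omega>) h \<in> B}
      = emeasure M {\<omega> \<in> space M. crossing (path \<omega>) h k \<and> grid_stream (path \<omega>) h (k + 1) \<in> B}"
      using iff[of k] by (intro emeasure_eq_AE) (auto simp: stream_after_def elim!: eventually_mono)
    also have "\<dots> = emeasure M {\<omega> \<in> space M. crossing (path \<omega>) h k} * ?q"
      using prob_crossing_stream[OF h B, of k]
      by (simp add: emeasure_eq_measure S.emeasure_eq_measure ennreal_mult)
    also have "emeasure M {\<omega> \<in> space M. crossing (path \<omega>) h k} = emeasure M {\<omega> \<in> space M. ?K \<omega> = k}"
      using iff[of k] by (intro emeasure_eq_AE) (auto elim!: eventually_mono)
    finally show ?thesis .
  qed
  have "emeasure (distr M (stream_space borel) (\<lambda>\<omega>. stream_after (path \<omega>) h)) B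
    = emeasure M {\<omega> \<in> space M. stream_after (path \<omega>) h \<in> B}"
    by (subst emeasure_distr) (auto simp: vimage_def Int_def conj_commute)
  also have "\<dots> = emeasure M (\<Union>k\<in>UNIV. {\<omega> \<in> space M. ?K \<omega> = k \<and> stream_after (path \<omega>) h \<in> B})"
    by (rule arg_cong[where f="emeasure M"]) auto
  also have "\<dots> = (\<integral>\<^sup>+k. emeasure M {\<omega> \<in> space M. ?K \<omega> = k \<and> stream_after (path \<omega>) h \<in> B} \<partial>count_space UNIV)"
    by (rule emeasure_UN_countable) (auto simp: disjoint_family_on_def)
  also have "\<dots> = (\<integral>\<^sup>+k. emeasure M {\<omega> \<in> space M. ?K \<omega> = k} \<partial>count_space UNIV) * ?q"
    unfolding * by (rule nn_integral_multc) simp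
  also have "(\<integral>\<^sup>+k. emeasure M {\<omega> \<in> space M. ?K \<omega> = k} \<partial>count_space UNIV)
    = emeasure M (\<Union>k\<in>UNIV. {\<omega> \<in> space M. ?K \<omega> = k})"
    by (rule emeasure_UN_countable[symmetric]) (auto simp: disjoint_family_on_def)
  also have "(\<Union>k\<in>UNIV. {\<omega> \<in> space M. ?K \<omega> = k}) = space M" by auto
  finally show "emeasure (distr M (stream_space borel) (\<lambda>\<omega>. stream_after (path \<omega>) h)) B = ?q"
    by (simp add: emeasure_space_1)
qed

lemma integral_stream_after:
  fixes g :: "real stream \<Rightarrow> complex"
  assumes "0 < \<theta>" "0 < h" and [measurable]: "g \<in> borel_measurable (stream_space borel)"
  shows "(\<integral>\<omega>. g (stream_after (path \<omega>) h) \<partial>M) = (\<integral>s. g s \<partial>stream_space (incr_law h))"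
  unfolding distr_stream_after[OF assms(1,2), symmetric] by (rule integral_distr[symmetric]) measurable

end

section \<open>Limits of the weights and measurability of the range\<close>

lemma norm_cis_diff_le: "norm (cis x - cis y) \<le> min 2 \<bar>x - y\<bar>"
proof -
  have "cis x - cis y = cis y * (cis (x - y) - 1)"
    by (simp add: cis_mult right_diff_distrib)
  then have "norm (cis x - cis y) = norm (cis (x - y) - 1)"
    by (simp add: norm_mult)
  also have "\<dots> \<le> \<bar>x - y\<bar>"
    using iexp_approx1[of "x - y" 0] by (simp add: cis_conv_exp)
  finally have "norm (cis x - cis y) \<le> \<bar>x - y\<bar>" .
  moreover have "norm (cis x - cis y) \<le> 2"
    using norm_triangle_ineq4[of "cis x" "cis y"] by simp
  ultimately show ?thesis by simp
qed

lemma measurable_completion_AE: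
  assumes g: "g \<in> measurable M N" and eq: "AE x in M. f x = g x"
    and f: "\<And>x. x \<in> space M \<Longrightarrow> f x \<in> space N"
  shows "f \<in> measurable (completion M) N"
proof (rule measurableI)
  fix A assume A: "A \<in> sets N"
  obtain Z where Z: "{x \<in> space M. f x \<noteq> g x} \<subseteq> Z" "Z \<in> null_sets M"
    using eq unfolding eventually_ae_filter by auto
  have "f -` A \<inter> space (completion M)
    = (g -` A \<inter> space M - Z) \<union> (f -` A \<inter> space M \<inter> Z)"
    using Z(1) by auto
  also have "\<dots> \<in> sets (completion M)"
  proof (rule sets_completionI[OF refl _ Z(2)])
    show "g -` A \<inter> space M - Z \<in> sets M"
      using measurable_sets[OF g A] Z(2) by auto
  qed auto
  finally show "f -` A \<inter> space (completion M) \<in> sets (completion M)" .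
qed (use f in simp)

lemma exp_quotient_tendsto:
  fixes z :: complex
  assumes h: "h \<longlonglongrightarrow> (0::real)" "\<And>n. 0 < h n"
  shows "(\<lambda>n. (1 - exp (z * of_real (h n))) / of_real (h n)) \<longlonglongrightarrow> - z"
proof (cases "z = 0")
  case False
  have "((\<lambda>x::complex. (exp (0 + x) - exp 0) / x) \<longlongrightarrow> exp 0) (at 0)"
    using DERIV_exp[of "0::complex"] unfolding DERIV_def .
  moreover have "filterlim (\<lambda>n. z * of_real (h n)) (at 0) sequentially"
  proof (rule filterlim_atI)
    have "(\<lambda>n. z * of_real (h n)) \<longlonglongrightarrow> z * of_real 0"
      by (intro tendsto_intros h)
    then show "(\<lambda>n. z * of_real (h n)) \<longlonglongrightarrow> 0" by simp
    show "\<forall>\<^sub>F n in sequentially. z * of_real (h n) \<noteq> 0"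
      using False h(2) by (auto simp: less_imp_neq[symmetric])
  qed
  ultimately have "(\<lambda>n. (exp (0 + z * of_real (h n)) - exp 0) / (z * of_real (h n))) \<longlonglongrightarrow> exp 0"
    by (rule filterlim_compose)
  then have "(\<lambda>n. - z * ((exp (0 + z * of_real (h n)) - exp 0) / (z * of_real (h n)))) \<longlonglongrightarrow> - z * exp 0"
    by (intro tendsto_intros)
  moreover have "- z * ((exp (0 + z * k) - exp 0) / (z * k)) = (1 - exp (z * k)) / k" for k
  proof -
    have "- z * ((w - 1) / (z * k)) = (1 - w) / k" for w
      using False by (simp add: minus_divide_left)
    then show ?thesis by simp
  qed
  ultimately show ?thesis by simp
qed simp

primrec limit_weight :: "real \<Rightarrow> (real \<Rightarrow> complex) \<Rightarrow> real list \<Rightarrow> complex" where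
  "limit_weight \<theta> f [] = 1"
| "limit_weight \<theta> f (a # as)
    = of_real \<theta> / (of_real \<theta> - \<i> * of_real a) * f (a - hd0 as) * limit_weight \<theta> f as"

text \<open>With \<open>q = exp (- (\<theta> * h))\<close> both \<open>1 - q\<close> and
  \<open>1 - q * cis (a * h)\<close> vanish with \<open>h\<close>. Divided by \<open>h\<close> they
  are difference quotients of the exponential function, and the geometric waiting time becomes an
  exponential one.\<close>

lemma phase_weight_tendsto:
  assumes h: "h \<longlonglongrightarrow> 0" "\<And>n. 0 < h n" and \<theta>: "0 < \<theta>"
    and f: "\<And>b. (\<lambda>n. f n b) \<longlonglongrightarrow> f' b"
  shows "(\<lambda>n. phase_weight (exp (- (\<theta> * h n))) (h n) (f n) as) \<longlonglongrightarrow> limit_weight \<theta> f' as"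
proof (induction as)
  case (Cons a as)
  have nz: "of_real \<theta> - \<i> * of_real a \<noteq> (0::complex)"
    using \<theta> by (auto simp: complex_eq_iff)
  let ?q = "\<lambda>n. complex_of_real (exp (- (\<theta> * h n)))"
  have 1: "(\<lambda>n. (1 - ?q n) / of_real (h n)) \<longlonglongrightarrow> of_real \<theta>"
    using exp_quotient_tendsto[OF h, of "- of_real \<theta>"] by (simp flip: exp_of_real)
  have "?q n * cis (a * h n) = exp ((- of_real \<theta> + \<i> * of_real a) * of_real (h n))" for n
    by (simp add: cis_conv_exp flip: exp_of_real exp_add) (simp add: algebra_simps)
  then have 2: "(\<lambda>n. (1 - ?q n * cis (a * h n)) / of_real (h n)) \<longlonglongrightarrow> of_real \<theta> - \<i> * of_real a"
    using exp_quotient_tendsto[OF h, of "- of_real \<theta> + \<i> * of_real a"] by simp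
  have 3: "(\<lambda>n. cis (a * h n)) \<longlonglongrightarrow> 1"
  proof -
    have "(\<lambda>n. cis (a * h n)) \<longlonglongrightarrow> cis (a * 0)"
      by (intro tendsto_intros h)
    then show ?thesis by simp
  qed
  have "(\<lambda>n. (1 - ?q n) / of_real (h n) * cis (a * h n) / ((1 - ?q n * cis (a * h n)) / of_real (h n)))
    \<longlonglongrightarrow> of_real \<theta> * 1 / (of_real \<theta> - \<i> * of_real a)"
    by (intro tendsto_divide tendsto_mult 1 2 3 nz)
  also have "(\<lambda>n. (1 - ?q n) / of_real (h n) * cis (a * h n) / ((1 - ?q n * cis (a * h n)) / of_real (h n)))
    = (\<lambda>n. (1 - ?q n) * cis (a * h n) / (1 - ?q n * cis (a * h n)))"
    using h(2) by (simp add: fun_eq_iff less_imp_neq[symmetric])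
  finally show ?case
    unfolding phase_weight.simps limit_weight.simps
    by (intro tendsto_mult Cons.IH f) simp
qed simp

lemma measurable_nth_point [measurable]: "nth_point n \<in> borel_measurable point_sets"
proof -
  have [measurable]: "countable ({1<..} \<inter> \<rat> :: real set)"
    by (rule countable_subset[OF _ countable_rat]) auto
  show ?thesis
    unfolding nth_point_def[abs_def] by measurable
qed

lemma measurable_level_phase:
  assumes [measurable]: "x \<in> borel_measurable point_sets"
  shows "(\<lambda>S. level_phase (\<lambda>n. nth_point n S) as (x S) j) \<in> borel_measurable point_sets"
  using assms
proof (induction as arbitrary: x j)
  case (Cons a as)
  note Cons.prems[measurable]
  have [measurable]: "(\<lambda>S. level_phase (\<lambda>n. nth_point n S) as (nth_point (Suc j) S - nth_point j S) (Suc j))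
      \<in> borel_measurable point_sets"
    by (rule Cons.IH) measurable
  show ?case unfolding level_phase.simps by measurable
qed simp

text \<open>Each value is held for a while to the right of its time, hence also at a rational time;
  so countably many random variables describe the range.\<close>

lemma jump_path_rational:
  assumes "jump_path f"
  shows "f ` {0<..} = f ` ({0<..} \<inter> \<rat>)"
proof (intro equalityI subsetI)
  fix y assume "y \<in> f ` {0<..}"
  then obtain s where s: "0 < s" "y = f s" by blast
  have "\<forall>u>0. \<exists>v>u. \<forall>w\<in>{u..v}. f w = f u"
    using assms unfolding jump_path_def by (elim conjE)
  from spec[OF this, THEN mp, OF s(1)]
  obtain v where v: "s < v" "\<forall>w\<in>{s..v}. f w = f s" by (elim exE conjE)
  obtain w where w: "w \<in> \<rat>" "s < w" "w < v"
    using Rats_dense_in_real[OF v(1)] by blast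
  have "w \<in> {s..v}" using w by simp
  with v(2) s(2) have "y = f w" by metis
  moreover have "w \<in> {0<..} \<inter> \<rat>" using w s by simp
  ultimately show "y \<in> f ` ({0<..} \<inter> \<rat>)" by (rule image_eqI)
qed blast

text \<open>Each value of the sequence is represented by the first index at which it occurs.
  Conditions on indices are events, so counts of random values become measurable.\<close>

lemma emeasure_count_range:
  fixes g :: "nat \<Rightarrow> 'b"
  shows "emeasure (count_space UNIV) (range g \<inter> B)
    = emeasure (count_space UNIV) {n. g n \<in> B \<and> (\<forall>m\<in>{..<n}. g m \<noteq> g n)}"
    (is "_ = emeasure _ ?N")
proof -
  have "bij_betw g ?N (range g \<inter> B)"
  proof (rule bij_betw_imageI)
    show "inj_on g ?N"
    proof (rule linorder_inj_onI)
      fix m n assume "m < n" "m \<in> ?N" "n \<in> ?N"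
      then have "m \<in> {..<n}" "\<forall>m\<in>{..<n}. g m \<noteq> g n" by simp_all
      then show "g m \<noteq> g n" by (rule bspec[rotated])
    qed (simp add: linear)
    show "g ` ?N = range g \<inter> B"
    proof (intro equalityI subsetI)
      fix y assume y: "y \<in> range g \<inter> B"
      define l where "l = (LEAST n. g n = y)"
      have "\<exists>n. g n = y" using y by blast
      then have l: "g l = y" unfolding l_def by (rule LeastI_ex)
      have "g m \<noteq> g l" if "m \<in> {..<l}" for m
        using not_less_Least[of m "\<lambda>n. g n = y", folded l_def] that l by simp
      moreover have "g l \<in> B" using y l by simp
      ultimately have "l \<in> ?N" by (intro CollectI conjI ballI)
      then show "y \<in> g ` ?N" using l by (intro image_eqI[of _ g l]) simp_all
    next
      fix y assume "y \<in> g ` ?N"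
      then show "y \<in> range g \<inter> B" by (elim imageE) simp
    qed
  qed
  then have "finite ?N = finite (range g \<inter> B)" "card ?N = card (range g \<inter> B)"
    by (rule bij_betw_finite, rule bij_betw_same_card)
  then show ?thesis
    by (cases "finite ?N") simp_all
qed

context no_drift_ssa
begin

lemma measurable_process_range:
  assumes \<theta>: "0 < \<theta>"
  shows "process_range T \<in> measurable (completion M) point_sets"
proof (rule measurable_into_point_sets)
  show "process_range T \<omega> \<subseteq> {0<..}" for \<omega> by (simp add: process_range_def)
  fix B :: "real set" assume [measurable]: "B \<in> sets borel"
  define D where "D = ({0<..} \<inter> \<rat> :: real set)"
  have D: "countable D" "D \<noteq> {}"
  proof -
    show "countable D" unfolding D_def by (rule countable_subset[OF _ countable_rat]) simp
    have "1 \<in> D" by (simp add: D_def)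
    then show "D \<noteq> {}" by blast
  qed
  define r where "r = from_nat_into D"
  have r: "range r = D" unfolding r_def using D by (simp add: range_from_nat_into)
  have r_pos: "0 < r n" for n
  proof -
    have "r n \<in> D" using r by blast
    then show ?thesis by (simp add: D_def)
  qed
  have [measurable]: "T (r n) \<in> borel_measurable M" for n
    by (rule measurable_T) (rule r_pos)
  define new where
    "new \<omega> = {n. T (r n) \<omega> \<in> B \<inter> {0<..} \<and> (\<forall>m\<in>{..<n}. T (r m) \<omega> \<noteq> T (r n) \<omega>)}" for \<omega>
  have "(\<lambda>\<omega>. num_points B (process_range T \<omega>)) \<in> borel_measurable (completion M)"
  proof (rule measurable_completion_AE)
    have "(\<lambda>\<omega>. \<Sum>n. if T (r n) \<omega> \<in> B \<inter> {0<..} \<and> (\<forall>m\<in>{..<n}. T (r m) \<omega> \<noteq> T (r n) \<omega>)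
      then 1 else 0 :: ennreal) \<in> borel_measurable M"
      by measurable
    also have "(\<lambda>\<omega>. \<Sum>n. if T (r n) \<omega> \<in> B \<inter> {0<..} \<and> (\<forall>m\<in>{..<n}. T (r m) \<omega> \<noteq> T (r n) \<omega>)
      then 1 else 0 :: ennreal) = (\<lambda>\<omega>. \<Sum>n. indicator (new \<omega>) n)"
      by (simp only: new_def indicator_def of_bool_def mem_Collect_eq)
    also have "\<dots> = (\<lambda>\<omega>. emeasure (count_space UNIV) (new \<omega>))"
      by (simp only: nn_integral_count_space_nat[symmetric]) simp
    finally show "(\<lambda>\<omega>. emeasure (count_space UNIV) (new \<omega>)) \<in> borel_measurable M" .
    show "AE \<omega> in M. num_points B (process_range T \<omega>) = emeasure (count_space UNIV) (new \<omega>)"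
      using AE_jump_path[OF \<theta>]
    proof eventually_elim
      case (elim \<omega>)
      have "process_range T \<omega> = path \<omega> ` D \<inter> {0<..}"
        unfolding process_range_def using jump_path_rational[OF elim] by (simp add: D_def)
      also have "path \<omega> ` D = range (\<lambda>n. T (r n) \<omega>)"
        unfolding r[symmetric] by (simp add: image_image)
      finally have "process_range T \<omega> \<inter> B = range (\<lambda>n. T (r n) \<omega>) \<inter> (B \<inter> {0<..})"
        by blast
      then show ?case
        unfolding num_points_def new_def by (simp only: emeasure_count_range)
    qed
  qed simp
  then show "(\<lambda>\<omega>. num_points B (process_range T \<omega>)) \<in> borel_measurable (completion M)" .
qed

section \<open>The relative jump size and its characteristic functions\<close>

definition first_val :: "'a \<Rightarrow> real \<Rightarrow> real" where
  "first_val \<omega> h = stream_after (path \<omega>) h !! first_nz (stream_after (path \<omega>) h)"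

definition has_val :: "'a \<Rightarrow> real \<Rightarrow> bool" where
  "has_val \<omega> h \<longleftrightarrow> (\<exists>i. stream_after (path \<omega>) h !! i \<noteq> 0)"

text \<open>A copy of \<open>Y\<close>, realised by the jump from the first level above 1 to the
  second. The limit is taken along one sequence to be measurable; by
  \<open>first_gap_tendsto\<close> it is almost surely the limit along all meshes.\<close>

definition gap :: "'a \<Rightarrow> real" where
  "gap \<omega> = lim (\<lambda>n. first_val \<omega> (1 / real (Suc n)))"

lemma measurable_first_val [measurable]: "(\<lambda>\<omega>. first_val \<omega> h) \<in> borel_measurable M"
  unfolding first_val_def
  by (rule measurable_compose[OF measurable_stream_after measurable_snth_first_nz])

lemma measurable_has_val [measurable]: "Measurable.pred M (\<lambda>\<omega>. has_val \<omega> h)"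
  unfolding has_val_def
  by (rule measurable_compose[OF measurable_stream_after measurable_pred_nz])

lemma measurable_gap [measurable]: "gap \<in> borel_measurable M"
  unfolding gap_def[abs_def] by (rule borel_measurable_lim_metric) measurable

lemma AE_gap:
  assumes \<theta>: "0 < \<theta>"
  shows "AE \<omega> in M. 0 < gap \<omega> \<and> (first_val \<omega> \<longlongrightarrow> gap \<omega>) (at_right 0)
    \<and> eventually (has_val \<omega>) (at_right 0)"
  using AE_jump_path[OF \<theta>]
proof eventually_elim
  case (elim \<omega>)
  obtain z where z: "levels (path \<omega> ` {0<..}) z" using jump_path_levels[OF elim] .
  obtain y where y: "0 < y" "(first_val \<omega> \<longlongrightarrow> y) (at_right 0)" "eventually (has_val \<omega>) (at_right 0)"
    using first_gap_tendsto[OF elim z] unfolding first_val_def[symmetric] has_val_def[symmetric] .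
  have "filterlim (\<lambda>n. 1 / real (Suc n)) (at_right 0) sequentially"
    using LIMSEQ_Suc[OF lim_const_over_n[of 1]] by (auto intro!: tendsto_imp_filterlim_at_right)
  then have "(\<lambda>n. first_val \<omega> (1 / real (Suc n))) \<longlonglongrightarrow> y"
    by (rule filterlim_compose[OF y(2)])
  then have "gap \<omega> = y" unfolding gap_def by (rule limI)
  with y show ?case by simp
qed

text \<open>With \<open>w = 1\<close> the first-entry formula says that the first nonzero entry has
  the law of an increment conditioned to be nonzero.\<close>

lemma integral_first_val:
  fixes F :: "real \<Rightarrow> complex"
  assumes \<theta>: "0 < \<theta>" and h: "0 < h" and [measurable]: "F \<in> borel_measurable borel"
    and F: "\<And>z. norm (F z) \<le> B"
  shows "(\<integral>\<omega>. (if has_val \<omega> h then F (first_val \<omega> h) else 0) \<partial>M)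
    = (\<integral>z. indicator (- {0}) z * F z \<partial>incr_law h) / (1 - of_real (exp (- (\<theta> * h))))"
proof -
  interpret I: real_distribution "incr_law h" by (rule real_distribution_incr_law)
  interpret S: prob_space "stream_space (incr_law h)" by (rule I.prob_space_stream_space)
  have q: "I.prob {0} = exp (- (\<theta> * h))" using h by (intro incr_law_0) simp
  have m: "case_prod (\<lambda>z s. F z) \<in> borel_measurable (borel \<Otimes>\<^sub>M stream_space borel)"
    unfolding split_beta by measurable
  have "(\<integral>\<omega>. (if has_val \<omega> h then F (first_val \<omega> h) else 0) \<partial>M)
    = (\<integral>\<omega>. at_first_nz 1 (\<lambda>z s. F z) (stream_after (path \<omega>) h) \<partial>M)"
    by (simp only: at_first_nz_def has_val_def first_val_def power_one mult_1_left)
  also have "\<dots> = (\<integral>s. at_first_nz 1 (\<lambda>z s. F z) s \<partial>stream_space (incr_law h))"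
    by (rule integral_stream_after[OF \<theta> h measurable_at_first_nz[OF m]])
  also have "\<dots> = 1 / (1 - of_real (I.prob {0}) * 1)
      * (\<integral>z. indicator (- {0}) z * (\<integral>s. F z \<partial>stream_space (incr_law h)) \<partial>incr_law h)"
    by (rule I.integral_at_first_nz[OF m F]) (use \<theta> h in \<open>auto simp: q\<close>)
  finally show ?thesis by (simp add: q S.prob_space)
qed

definition log_gap_char :: "real \<Rightarrow> complex" where
  "log_gap_char b = (\<integral>\<omega>. cis (b * ln (gap \<omega>)) \<partial>M)"

definition log_incr_char :: "real \<Rightarrow> real \<Rightarrow> complex" where
  "log_incr_char h b = (\<integral>z. indicator (- {0}) z * cis (b * ln z) \<partial>incr_law h)
     / (1 - of_real (exp (- (\<theta> * h))))"

text \<open>By \<open>integral_first_val\<close> the conditioned increments for all \<open>h\<close>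
  are realised by \<open>first_val\<close> on one probability space, where they converge almost
  surely to \<open>gap\<close>; dominated convergence does the rest.\<close>

lemma log_incr_char_tendsto:
  assumes \<theta>: "0 < \<theta>" and h: "h \<longlonglongrightarrow> 0" "\<And>n. 0 < h n"
  shows "(\<lambda>n. log_incr_char (h n) b) \<longlonglongrightarrow> log_gap_char b"
proof -
  have at0: "filterlim h (at_right 0) sequentially"
    using h by (auto intro!: tendsto_imp_filterlim_at_right)
  have "(\<lambda>n. \<integral>\<omega>. (if has_val \<omega> (h n) then cis (b * ln (first_val \<omega> (h n))) else 0) \<partial>M) \<longlonglongrightarrow> log_gap_char b"
    unfolding log_gap_char_def
  proof (rule integral_dominated_convergence[where w="\<lambda>_. 1"])
    show "AE \<omega> in M. (\<lambda>n. if has_val \<omega> (h n) then cis (b * ln (first_val \<omega> (h n))) else 0)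
      \<longlonglongrightarrow> cis (b * ln (gap \<omega>))"
      using AE_gap[OF \<theta>]
    proof eventually_elim
      case (elim \<omega>)
      then have "(\<lambda>n. first_val \<omega> (h n)) \<longlonglongrightarrow> gap \<omega>"
        using filterlim_compose[OF _ at0] by blast
      then have "(\<lambda>n. cis (b * ln (first_val \<omega> (h n)))) \<longlonglongrightarrow> cis (b * ln (gap \<omega>))"
        using elim by (intro tendsto_intros) auto
      moreover have "eventually (\<lambda>n. has_val \<omega> (h n)) sequentially"
        using elim at0 unfolding filterlim_iff by blast
      then have "eventually (\<lambda>n. cis (b * ln (first_val \<omega> (h n))) = (if has_val \<omega> (h n) then cis (b * ln (first_val \<omega> (h n))) else 0)) sequentially"
        by eventually_elim simp
      ultimately show ?case
        by (rule Lim_transform_eventually)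
    qed
  qed auto
  moreover have "(\<integral>\<omega>. (if has_val \<omega> (h n) then cis (b * ln (first_val \<omega> (h n))) else 0) \<partial>M)
    = log_incr_char (h n) b" for n
    unfolding log_incr_char_def
    by (rule integral_first_val[OF \<theta> h(2), where B=1]) auto
  ultimately show ?thesis by simp
qed

text \<open>Ratios of gaps call for the transform of \<open>ln gap\<close>, sums of increments for
  that of \<open>gap\<close> itself.\<close>

definition char_gap :: "real \<Rightarrow> complex" where
  "char_gap v = (\<integral>\<omega>. cis (v * gap \<omega>) \<partial>M)"

definition incr_char :: "real \<Rightarrow> real \<Rightarrow> complex" where
  "incr_char h v = (\<integral>z. indicator (- {0}) z * cis (v * z) \<partial>incr_law h)
     / (1 - of_real (exp (- (\<theta> * h))))"

text \<open>Bounds the error of replacing \<open>gap\<close> by \<open>first_val\<close> in a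
  characteristic function, uniformly over frequencies of modulus at most \<open>U\<close>, since a
  refining grid involves ever more frequencies at once. The value 2 covers paths without a nonzero
  entry.\<close>

definition val_dist :: "real \<Rightarrow> real \<Rightarrow> real" where
  "val_dist U h = (\<integral>\<omega>. (if has_val \<omega> h then min 2 (U * \<bar>first_val \<omega> h - gap \<omega>\<bar>) else 2) \<partial>M)"

lemma val_dist_tendsto:
  assumes \<theta>: "0 < \<theta>" and h: "h \<longlonglongrightarrow> 0" "\<And>n. 0 < h n" and U: "0 \<le> U"
  shows "(\<lambda>n. val_dist U (h n)) \<longlonglongrightarrow> 0"
proof -
  have at0: "filterlim h (at_right 0) sequentially"
    using h by (auto intro!: tendsto_imp_filterlim_at_right)
  have "(\<lambda>n. val_dist U (h n)) \<longlonglongrightarrow> (\<integral>\<omega>. 0 \<partial>M)"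
    unfolding val_dist_def
  proof (rule integral_dominated_convergence[where w="\<lambda>_. 2"])
    show "AE \<omega> in M. (\<lambda>n. if has_val \<omega> (h n) then min 2 (U * \<bar>first_val \<omega> (h n) - gap \<omega>\<bar>) else 2) \<longlonglongrightarrow> 0"
      using AE_gap[OF \<theta>]
    proof eventually_elim
      case (elim \<omega>)
      then have "(\<lambda>n. first_val \<omega> (h n)) \<longlonglongrightarrow> gap \<omega>"
        using filterlim_compose[OF _ at0] by blast
      then have "(\<lambda>n. min 2 (U * \<bar>first_val \<omega> (h n) - gap \<omega>\<bar>)) \<longlonglongrightarrow> min 2 (U * \<bar>gap \<omega> - gap \<omega>\<bar>)"
        by (intro tendsto_intros)
      then have "(\<lambda>n. min 2 (U * \<bar>first_val \<omega> (h n) - gap \<omega>\<bar>)) \<longlonglongrightarrow> 0" by simp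
      moreover have "eventually (\<lambda>n. has_val \<omega> (h n)) sequentially"
        using elim at0 unfolding filterlim_iff by blast
      then have "eventually (\<lambda>n. min 2 (U * \<bar>first_val \<omega> (h n) - gap \<omega>\<bar>) = (if has_val \<omega> (h n) then min 2 (U * \<bar>first_val \<omega> (h n) - gap \<omega>\<bar>) else 2)) sequentially"
        by eventually_elim simp
      ultimately show ?case
        by (rule Lim_transform_eventually)
    qed
  qed (use U in auto)
  then show ?thesis by simp
qed

lemma incr_char_dist:
  assumes \<theta>: "0 < \<theta>" and h: "0 < h" and v: "\<bar>v\<bar> \<le> U"
  shows "norm (incr_char h v - char_gap v) \<le> val_dist U h"
proof -
  let ?f = "\<lambda>\<omega>. if has_val \<omega> h then cis (v * first_val \<omega> h) else 0"
  have "incr_char h v = (\<integral>\<omega>. ?f \<omega> \<partial>M)"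
    unfolding incr_char_def by (rule integral_first_val[OF \<theta> h, symmetric, where B=1]) auto
  then have "incr_char h v - char_gap v = (\<integral>\<omega>. ?f \<omega> - cis (v * gap \<omega>) \<partial>M)"
    unfolding char_gap_def
    by (subst Bochner_Integration.integral_diff) (auto intro!: integrable_const_bound[of _ 1])
  also have "norm \<dots> \<le> (\<integral>\<omega>. norm (?f \<omega> - cis (v * gap \<omega>)) \<partial>M)"
    by (rule integral_norm_bound)
  also have "\<dots> \<le> val_dist U h"
    unfolding val_dist_def
  proof (rule integral_mono)
    have U: "0 \<le> U" using v by simp
    show "integrable M (\<lambda>\<omega>. norm (?f \<omega> - cis (v * gap \<omega>)))"
    proof (rule integrable_const_bound[of _ 2])
      show "AE \<omega> in M. norm (norm (?f \<omega> - cis (v * gap \<omega>))) \<le> 2"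
        using norm_triangle_ineq4[of "cis x" "cis y" for x y] by auto
    qed measurable
    show "integrable M (\<lambda>\<omega>. if has_val \<omega> h then min 2 (U * \<bar>first_val \<omega> h - gap \<omega>\<bar>) else 2)"
      by (rule integrable_const_bound[of _ 2]) (use U in auto)
    fix \<omega>
    have "norm (cis (v * x) - cis (v * y)) \<le> min 2 (U * \<bar>x - y\<bar>)" for x y
    proof -
      have "\<bar>v * x - v * y\<bar> = \<bar>v\<bar> * \<bar>x - y\<bar>" by (simp add: abs_mult flip: right_diff_distrib)
      also have "\<dots> \<le> U * \<bar>x - y\<bar>" by (rule mult_right_mono[OF v]) simp
      finally show ?thesis using norm_cis_diff_le[of "v * x" "v * y"] by simp
    qed
    then show "norm (?f \<omega> - cis (v * gap \<omega>))
      \<le> (if has_val \<omega> h then min 2 (U * \<bar>first_val \<omega> h - gap \<omega>\<bar>) else 2)"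
      by auto
  qed
  finally show ?thesis .
qed

text \<open>The limit of the same expectations is found in two ways: path by path,
  \<open>gap_phase\<close> eventually equals a function of the range; in law, its expectation is an
  explicit product of waiting time and increment transforms.\<close>

lemma integral_range_law:
  assumes \<theta>: "0 < \<theta>"
  shows "(\<integral>S. level_phase (\<lambda>n. nth_point n S) (0 # as) 1 0 \<partial>range_law M T)
    = limit_weight \<theta> log_gap_char (0 # as)"
proof -
  interpret C: prob_space "completion M"
    by (rule prob_spaceI) (simp add: emeasure_space_1)
  let ?G = "\<lambda>S. level_phase (\<lambda>n. nth_point n S) (0 # as) 1 0"
  define h where "h n = 1 / real (Suc n)" for n
  have h: "h \<longlonglongrightarrow> 0" "\<And>n. 0 < h n"
    unfolding h_def using LIMSEQ_Suc[OF lim_const_over_n[of 1]] by auto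
  have at0: "filterlim h (at_right 0) sequentially"
    using h by (auto intro!: tendsto_imp_filterlim_at_right)
  let ?F = "\<lambda>n \<omega>. gap_phase (h n) (0 # as) 1 (stream_after (path \<omega>) (h n))"
  have G[measurable]: "?G \<in> borel_measurable point_sets"
    by (rule measurable_level_phase) simp
  have meas: "gap_phase (h n) (0 # as) 1 \<in> borel_measurable (stream_space borel)" for n
    using measurable_Pair2[OF measurable_gap_phase, of 1] by simp
  have FM: "?F n \<in> borel_measurable M" for n
    by (rule measurable_compose[OF measurable_stream_after meas])
  have conv: "AE \<omega> in completion M. (\<lambda>n. ?F n \<omega>) \<longlonglongrightarrow> ?G (process_range T \<omega>)"
    unfolding AE_completion_iff using AE_jump_path[OF \<theta>]
  proof eventually_elim
    case (elim \<omega>)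
    obtain z where z: "levels (path \<omega> ` {0<..}) z" using jump_path_levels[OF elim] .
    have "process_range T \<omega> \<inter> {1<..y} = path \<omega> ` {0<..} \<inter> {1<..y}" for y
      by (auto simp: process_range_def)
    then have "levels (process_range T \<omega>) z"
      using z by (simp add: levels_def)
    then have "(\<lambda>n. nth_point n (process_range T \<omega>)) = z"
      by (intro ext nth_point_levels)
    moreover have "eventually (\<lambda>n. ?F n \<omega> = level_phase z (0 # as) 1 0) sequentially"
      using eventually_gap_phase[OF elim z, of as] at0 unfolding filterlim_iff by blast
    ultimately show ?case
      by (auto intro: tendsto_eventually)
  qed
  have "(\<lambda>n. \<integral>\<omega>. ?F n \<omega> \<partial>completion M) \<longlonglongrightarrow> (\<integral>\<omega>. ?G (process_range T \<omega>) \<partial>completion M)"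
  proof (rule integral_dominated_convergence[where w="\<lambda>_. 1", OF _ _ _ conv])
    show "(\<lambda>\<omega>. ?G (process_range T \<omega>)) \<in> borel_measurable (completion M)"
      by (rule measurable_compose[OF measurable_process_range[OF \<theta>] G])
    show "?F n \<in> borel_measurable (completion M)" for n
      by (rule measurable_completion[OF FM])
  qed (use norm_gap_phase in auto)
  moreover have "(\<integral>\<omega>. ?F n \<omega> \<partial>completion M)
    = phase_weight (exp (- (\<theta> * h n))) (h n) (log_incr_char (h n)) (0 # as)" for n
  proof -
    interpret I: real_distribution "incr_law (h n)" by (rule real_distribution_incr_law)
    have q: "I.prob {0} = exp (- (\<theta> * h n))" using h(2)[of n] by (intro incr_law_0) simp
    have "(\<integral>\<omega>. ?F n \<omega> \<partial>completion M) = (\<integral>\<omega>. ?F n \<omega> \<partial>M)"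
      by (rule integral_completion[OF FM])
    also have "\<dots> = (\<integral>s. gap_phase (h n) (0 # as) 1 s \<partial>stream_space (incr_law (h n)))"
      by (rule integral_stream_after[OF \<theta> h(2) meas])
    also have "\<dots> = cis (- hd0 (0 # as) * ln 1) * phase_weight (I.prob {0}) (h n) (log_incr_char (h n)) (0 # as)"
    proof (rule I.integral_gap_phase)
      show "I.prob {0} < 1" unfolding q using \<theta> h(2)[of n] by simp
    qed (simp add: log_incr_char_def q)
    finally show ?thesis by (simp add: q)
  qed
  ultimately have "(\<lambda>n. phase_weight (exp (- (\<theta> * h n))) (h n) (log_incr_char (h n)) (0 # as))
      \<longlonglongrightarrow> (\<integral>\<omega>. ?G (process_range T \<omega>) \<partial>completion M)"
    by simp
  moreover have "(\<lambda>n. phase_weight (exp (- (\<theta> * h n))) (h n) (log_incr_char (h n)) (0 # as))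
      \<longlonglongrightarrow> limit_weight \<theta> log_gap_char (0 # as)"
    by (intro phase_weight_tendsto h \<theta> log_incr_char_tendsto)
  ultimately have "(\<integral>\<omega>. ?G (process_range T \<omega>) \<partial>completion M) = limit_weight \<theta> log_gap_char (0 # as)"
    by (rule LIMSEQ_unique)
  moreover have "(\<integral>S. ?G S \<partial>range_law M T) = (\<integral>\<omega>. ?G (process_range T \<omega>) \<partial>completion M)"
    unfolding range_law_def by (rule integral_distr[OF measurable_process_range[OF \<theta>] G])
  ultimately show ?thesis by simp
qed

end

section \<open>Recovering the jump law up to scale\<close>

primrec phase_prod :: "(real \<Rightarrow> complex) \<Rightarrow> real list \<Rightarrow> complex" where
  "phase_prod f [] = 1"
| "phase_prod f (a # as) = f (a - hd0 as) * phase_prod f as"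

text \<open>The waiting time factors depend only on \<theta> and the exponents, and they never
  vanish.\<close>

lemma limit_weight_cancel:
  assumes "limit_weight \<theta> f as = limit_weight \<theta> g as" and \<theta>: "0 < \<theta>"
  shows "phase_prod f as = phase_prod g as"
proof -
  define C where "C = (\<Prod>a\<leftarrow>as. of_real \<theta> / (of_real \<theta> - \<i> * of_real a) :: complex)"
  have nz: "of_real \<theta> - \<i> * of_real a \<noteq> (0::complex)" for a
    using \<theta> by (auto simp: complex_eq_iff)
  have eq: "limit_weight \<theta> f as = C * phase_prod f as" for f
    unfolding C_def by (induction as) auto
  have "C \<noteq> 0"
    unfolding C_def using \<theta> nz by (induction as) auto
  with assms(1) show ?thesis unfolding eq by simp
qed

text \<open>Exponents in arithmetic progression, all with difference \<open>- d\<close>. After a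
  leading 0, \<open>phase_prod\<close> couples \<open>f (n * d)\<close> with a power of
  \<open>f (- d)\<close>, which for a characteristic function and small \<open>d\<close> is close to
  1 and can be divided out.\<close>

primrec down_steps :: "real \<Rightarrow> nat \<Rightarrow> real list" where
  "down_steps d 0 = []"
| "down_steps d (Suc n) = (- real (Suc n) * d) # down_steps d n"

lemma hd0_down_steps: "hd0 (down_steps d n) = - real n * d"
  by (cases n) auto

lemma phase_prod_down_steps: "phase_prod f (0 # down_steps d n) = f (real n * d) * f (- d) ^ n"
proof -
  have "phase_prod f (down_steps d n) = f (- d) ^ n"
    by (induction n) (simp_all add: hd0_down_steps algebra_simps)
  then show ?thesis by (simp add: hd0_down_steps)
qed

lemma dyadic_tendsto:
  fixes x :: real
  assumes "0 \<le> x"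
  shows "(\<lambda>m. real (nat \<lfloor>x * 2 ^ m\<rfloor>) * (1 / 2 ^ m)) \<longlonglongrightarrow> x"
proof (rule tendsto_sandwich)
  have *: "x * 2 ^ m - 1 \<le> real (nat \<lfloor>x * 2 ^ m\<rfloor>)" "real (nat \<lfloor>x * 2 ^ m\<rfloor>) \<le> x * 2 ^ m" for m
  proof -
    have "real (nat \<lfloor>x * 2 ^ m\<rfloor>) = of_int \<lfloor>x * 2 ^ m\<rfloor>"
      using assms by simp
    then show "x * 2 ^ m - 1 \<le> real (nat \<lfloor>x * 2 ^ m\<rfloor>)" "real (nat \<lfloor>x * 2 ^ m\<rfloor>) \<le> x * 2 ^ m"
      by linarith+
  qed
  show "\<forall>\<^sub>F m in sequentially. x - (1 / 2) ^ m \<le> real (nat \<lfloor>x * 2 ^ m\<rfloor>) * (1 / 2 ^ m)"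
  proof (intro always_eventually allI)
    fix m
    have "x - (1 / 2) ^ m = (x * 2 ^ m - 1) * (1 / 2 ^ m)"
      by (simp add: field_simps)
    also have "\<dots> \<le> real (nat \<lfloor>x * 2 ^ m\<rfloor>) * (1 / 2 ^ m)"
      by (rule mult_right_mono[OF *(1)]) simp
    finally show "x - (1 / 2) ^ m \<le> real (nat \<lfloor>x * 2 ^ m\<rfloor>) * (1 / 2 ^ m)" .
  qed
  show "\<forall>\<^sub>F m in sequentially. real (nat \<lfloor>x * 2 ^ m\<rfloor>) * (1 / 2 ^ m) \<le> x"
  proof (intro always_eventually allI)
    fix m
    have "real (nat \<lfloor>x * 2 ^ m\<rfloor>) * (1 / 2 ^ m) \<le> x * 2 ^ m * (1 / 2 ^ m)"
      by (rule mult_right_mono[OF *(2)]) simp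
    then show "real (nat \<lfloor>x * 2 ^ m\<rfloor>) * (1 / 2 ^ m) \<le> x" by simp
  qed
  have "(\<lambda>m. x - (1 / 2) ^ m) \<longlonglongrightarrow> x - 0"
    by (intro tendsto_intros LIMSEQ_realpow_zero) auto
  then show "(\<lambda>m. x - (1 / 2) ^ m) \<longlonglongrightarrow> x" by simp
qed simp

text \<open>Near \<open>0\<close> the quotient \<open>f / g\<close> is a unimodular number of positive real part whose argument halves
  with its argument; this fixes the shift \<open>\<gamma>\<close>, and the product relation carries it from
  \<open>2\<^sup>-\<^sup>m\<close> to all multiples of \<open>2\<^sup>-\<^sup>m\<close>, even where \<open>f\<close> and \<open>g\<close> vanish.\<close>

lemma shift_of_product_relation:
  fixes f g :: "real \<Rightarrow> complex"
  assumes cf: "\<And>x. isCont f x" and cg: "\<And>x. isCont g x"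
    and f0: "f 0 = 1" and g0: "g 0 = 1"
    and fm: "\<And>x. f (- x) = cnj (f x)" and gm: "\<And>x. g (- x) = cnj (g x)"
    and rel: "\<And>n d. f (real n * d) * f (- d) ^ n = g (real n * d) * g (- d) ^ n"
  obtains \<gamma> where "\<And>x. f x = cis (\<gamma> * x) * g x"
proof -
  define x :: "nat \<Rightarrow> real" where "x m = 1 / 2 ^ m" for m
  define r where "r y = f y / g y" for y
  have x0: "x \<longlonglongrightarrow> 0"
    using LIMSEQ_realpow_zero[of "1/2"] by (simp add: x_def[abs_def] power_one_over)
  have "isCont r 0"
    unfolding r_def[abs_def] using g0 by (intro continuous_intros cf cg) simp
  then have lim_r: "(\<lambda>m. Re (r (x m))) \<longlonglongrightarrow> Re (r 0)"
    by (intro tendsto_Re isCont_tendsto_compose[OF _ x0])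
  have lim_f: "(\<lambda>m. Re (f (x m))) \<longlonglongrightarrow> Re (f 0)" and lim_g: "(\<lambda>m. Re (g (x m))) \<longlonglongrightarrow> Re (g 0)"
    by (intro tendsto_Re isCont_tendsto_compose[OF _ x0] cf cg)+
  have "eventually (\<lambda>m. 0 < Re (r (x m)) \<and> 0 < Re (f (x m)) \<and> 0 < Re (g (x m))) sequentially"
    using order_tendstoD(1)[OF lim_r, of 0] order_tendstoD(1)[OF lim_f, of 0]
      order_tendstoD(1)[OF lim_g, of 0] f0 g0 by (simp add: r_def eventually_conj_iff)
  then obtain m0 where m0: "\<And>m. m0 \<le> m \<Longrightarrow> 0 < Re (r (x m)) \<and> 0 < Re (f (x m)) \<and> 0 < Re (g (x m))"
    unfolding eventually_sequentially by blast
  have nz: "f (x m) \<noteq> 0" "g (x m) \<noteq> 0" if "m0 \<le> m" for m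
    using m0[OF that] by auto
  \<comment> \<open>The relation with \<open>n = 1\<close> equates the squared moduli of
    \<open>f\<close> and \<open>g\<close>.\<close>
  have norm: "norm (r (x m)) = 1" if "m0 \<le> m" for m
  proof -
    have "f (x m) * cnj (f (x m)) = g (x m) * cnj (g (x m))"
      using rel[of 1 "x m"] by (simp add: fm gm)
    then have "(norm (f (x m)))\<^sup>2 = (norm (g (x m)))\<^sup>2"
      by (simp only: complex_norm_square[symmetric] of_real_eq_iff)
    then have "norm (f (x m)) = norm (g (x m))" by simp
    then show ?thesis using nz[OF that] by (simp add: r_def norm_divide)
  qed
  define \<alpha> where "\<alpha> m = Arg (r (x m))" for m
  have \<alpha>: "r (x m) = cis (\<alpha> m)" "\<bar>\<alpha> m\<bar> < pi / 2" if "m0 \<le> m" for m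
  proof -
    have "r (x m) \<noteq> 0" using m0[OF that] by auto
    then show "r (x m) = cis (\<alpha> m)"
      using norm[OF that] by (simp add: \<alpha>_def cis_Arg sgn_div_norm)
    show "\<bar>\<alpha> m\<bar> < pi / 2"
      unfolding \<alpha>_def Arg_Re_pos using m0[OF that] by blast
  qed
  have fg: "f (x m) = cis (\<alpha> m) * g (x m)" if "m0 \<le> m" for m
    using \<alpha>(1)[OF that] nz[OF that] by (simp add: r_def field_simps)
  have mult: "f (real k * x m) = cis (real k * \<alpha> m) * g (real k * x m)" if "m0 \<le> m" for k m
  proof -
    have "f (- x m) = cis (- \<alpha> m) * g (- x m)"
      using fg[OF that] by (simp add: fm gm cis_cnj)
    then have "f (real k * x m) * (cis (- \<alpha> m) ^ k * g (- x m) ^ k) = g (real k * x m) * g (- x m) ^ k"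
      using rel[of k "x m"] by (simp add: power_mult_distrib)
    moreover have "g (- x m) \<noteq> 0" using nz[OF that] by (simp add: gm)
    moreover have "F = cis (real k * a) * G"
      if "F * (cis (- a) ^ k * w ^ k) = G * w ^ k" "w \<noteq> 0" for F G w :: complex and a
    proof -
      have "F * cis (- a) ^ k = G" using that by (simp add: mult.assoc[symmetric])
      then have "cis (real k * a) * G = F * (cis (- a) ^ k * cis (real k * a))"
        by (simp add: mult.assoc mult.commute mult.left_commute)
      also have "cis (- a) ^ k * cis (real k * a) = 1"
        unfolding Complex.DeMoivre cis_mult by simp
      finally show ?thesis by simp
    qed
    ultimately show ?thesis by blast
  qed
  have half: "\<alpha> m = 2 * \<alpha> (Suc m)" if "m0 \<le> m" for m
  proof -
    have m: "m0 \<le> Suc m" using that by simp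
    have "2 * x (Suc m) = x m" by (simp add: x_def)
    then have "f (x m) = cis (2 * \<alpha> (Suc m)) * g (x m)"
      using mult[OF m, of 2] by simp
    then have "cis (2 * \<alpha> (Suc m)) * g (x m) = cis (\<alpha> m) * g (x m)"
      using fg[OF that] by metis
    then have eq: "cis (2 * \<alpha> (Suc m)) = cis (\<alpha> m)"
      using nz(2)[OF that] mult_right_cancel by blast
    \<comment> \<open>As \<open>\<alpha> (Suc m)\<close> has modulus below \<open>pi / 2\<close>,
      its double is still a principal argument, so no multiple of \<open>2 * pi\<close> can
      intervene.\<close>
    have "\<alpha> m = Arg (cis (\<alpha> m))"
      using \<alpha>(2)[OF that] pi_gt_zero by (intro Arg_cis[symmetric]) auto
    also have "\<dots> = Arg (cis (2 * \<alpha> (Suc m)))"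
      by (simp only: eq)
    also have "\<dots> = 2 * \<alpha> (Suc m)"
      using \<alpha>(2)[OF m] by (intro Arg_cis) auto
    finally show ?thesis .
  qed
  \<comment> \<open>Halving at every step makes \<open>\<alpha> m * 2 ^ m\<close> constant from
    \<open>m0\<close> on; this constant is the shift.\<close>
  define \<gamma> where "\<gamma> = \<alpha> m0 * 2 ^ m0"
  have \<gamma>: "\<alpha> m = \<gamma> * x m" if "m0 \<le> m" for m
    using that
  proof (induction m rule: dec_induct)
    case base
    show ?case by (simp add: \<gamma>_def x_def)
  next
    case (step m)
    then show ?case using half[of m] by (simp add: x_def)
  qed
  have pos: "f y = cis (\<gamma> * y) * g y" if "0 \<le> y" for y
  proof -
    define k where "k m = real (nat \<lfloor>y * 2 ^ m\<rfloor>) * x m" for m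
    have k: "k \<longlonglongrightarrow> y"
      using dyadic_tendsto[OF that] by (simp add: k_def[abs_def] x_def)
    have "eventually (\<lambda>m. cis (\<gamma> * k m) * g (k m) = f (k m)) sequentially"
      using eventually_ge_at_top[of m0]
    proof eventually_elim
      case (elim m)
      show ?case
        unfolding k_def mult[OF elim] \<gamma>[OF elim] by (simp add: algebra_simps)
    qed
    moreover have "(\<lambda>m. cis (\<gamma> * k m) * g (k m)) \<longlonglongrightarrow> cis (\<gamma> * y) * g y"
      by (intro tendsto_intros k isCont_tendsto_compose[OF cg])
    ultimately have "(\<lambda>m. f (k m)) \<longlonglongrightarrow> cis (\<gamma> * y) * g y"
      by (rule Lim_transform_eventually[rotated])
    moreover have "(\<lambda>m. f (k m)) \<longlonglongrightarrow> f y"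
      by (rule isCont_tendsto_compose[OF cf k])
    ultimately show ?thesis
      by (rule LIMSEQ_unique[symmetric])
  qed
  have "f y = cis (\<gamma> * y) * g y" for y
  proof (cases "0 \<le> y")
    case False
    then have "f (- y) = cis (\<gamma> * - y) * g (- y)" by (intro pos) simp
    then have "cnj (f y) = cnj (cis (\<gamma> * y) * g y)"
      by (simp add: fm gm cis_cnj)
    then show ?thesis by (simp only: complex_cnj_cancel_iff)
  qed (rule pos)
  then show ?thesis by (rule that)
qed

section \<open>Characteristic functions of the gap and of the increments\<close>

context no_drift_ssa
begin

lemma real_distribution_gap: "real_distribution (distr M borel (\<lambda>\<omega>. ln (gap \<omega>)))"
  by (rule real_distribution_distr) measurable

lemma char_log_gap: "char (distr M borel (\<lambda>\<omega>. ln (gap \<omega>))) b = log_gap_char b"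
  unfolding char_def log_gap_char_def by (subst integral_distr) (auto simp: cis_conv_exp)

lemma isCont_log_gap_char: "isCont log_gap_char b"
  using real_distribution.isCont_char[OF real_distribution_gap, of b]
  by (simp add: char_log_gap[abs_def])

lemma log_gap_char_0: "log_gap_char 0 = 1"
  by (simp add: log_gap_char_def prob_space)

lemma log_gap_char_minus: "log_gap_char (- b) = cnj (log_gap_char b)"
  unfolding log_gap_char_def by (simp add: cis_cnj flip: Bochner_Integration.integral_cnj)

lemma char_incr_law:
  assumes \<theta>: "0 < \<theta>" and h: "0 < h"
  shows "char (incr_law h) v = of_real (exp (- (\<theta> * h))) + (1 - of_real (exp (- (\<theta> * h)))) * incr_char h v"
proof -
  interpret I: real_distribution "incr_law h" by (rule real_distribution_incr_law)
  have q: "I.prob {0} = exp (- (\<theta> * h))" using h by (intro incr_law_0) simp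
  have "char (incr_law h) v = (\<integral>z. complex_of_real (indicator {0} z) + indicator (- {0}) z * cis (v * z) \<partial>incr_law h)"
    unfolding char_def
    by (intro Bochner_Integration.integral_cong) (auto simp: indicator_def cis_conv_exp)
  also have "\<dots> = (\<integral>z. complex_of_real (indicator {0} z) \<partial>incr_law h)
      + (\<integral>z. indicator (- {0}) z * cis (v * z) \<partial>incr_law h)"
    by (rule Bochner_Integration.integral_add)
      (auto intro!: I.integrable_const_bound[of _ 1] simp: indicator_def)
  also have "(\<integral>z. complex_of_real (indicator {0} z) \<partial>incr_law h) = of_real (exp (- (\<theta> * h)))"
    unfolding integral_complex_of_real by (simp add: q)
  also have "(\<integral>z. indicator (- {0}) z * cis (v * z) \<partial>incr_law h)
      = (1 - of_real (exp (- (\<theta> * h)))) * incr_char h v"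
  proof -
    have "exp (- (\<theta> * h)) \<noteq> 1" using \<theta> h by simp
    then have "1 - complex_of_real (exp (- (\<theta> * h))) \<noteq> 0"
      by (simp only: right_minus_eq of_real_eq_1_iff) simp
    then show ?thesis unfolding incr_char_def by (simp del: of_real_exp)
  qed
  finally show ?thesis .
qed

text \<open>The increment telescopes into \<open>n\<close> independent ones. By self-similarity the
  one starting at \<open>t i\<close> has the law of \<open>t i\<close> times
  \<open>T (exp h) - T 1\<close>, and the factor \<open>t i\<close> moves into the
  frequency.\<close>

lemma char_increment:
  assumes s: "0 < s" and h: "0 < h"
  shows "char (distr M borel (\<lambda>\<omega>. T (s * exp (h * real n)) \<omega> - T s \<omega>)) u
    = (\<Prod>i<n. char (incr_law h) (u * (s * exp (h * real i))))"
proof -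
  define t where "t i = s * exp (h * real i)" for i :: nat
  define X where "X i \<omega> = (if i = 0 then T (t 0) \<omega> else T (t i) \<omega> - T (t (i - 1)) \<omega>)" for i :: nat and \<omega>
  have t0: "0 < t i" for i using s by (simp add: t_def)
  have "indep_vars (\<lambda>_. borel) X UNIV"
    unfolding X_def by (rule indep_increments_UNIV) (use s h in \<open>auto simp: t_def strict_mono_def\<close>)
  then have "indep_vars (\<lambda>_. borel) X (Suc ` {..<n})"
    by (rule indep_vars_subset) simp
  note c = char_distr_sum[OF this, of u]
  have tel: "(\<Sum>i\<in>Suc ` {..<n}. X i \<omega>) = T (t n) \<omega> - T (t 0) \<omega>" for \<omega>
  proof -
    have "(\<Sum>i\<in>Suc ` {..<n}. X i \<omega>) = (\<Sum>i<n. T (t (Suc i)) \<omega> - T (t i) \<omega>)"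
      by (subst sum.reindex) (auto simp: X_def)
    also have "\<dots> = T (t n) \<omega> - T (t 0) \<omega>"
      by (rule sum_lessThan_telescope)
    finally show ?thesis .
  qed
  have Xi: "char (distr M borel (X (Suc i))) u = char (incr_law h) (u * t i)" for i
  proof -
    have [measurable]: "T (t i * exp h) \<in> borel_measurable M" "T (t i) \<in> borel_measurable M"
      using t0[of i] by (auto intro!: measurable_T)
    have tS: "t (Suc i) = t i * exp h"
      by (simp add: t_def algebra_simps exp_add)
    have "char (incr_law h) (u * t i)
      = (\<integral>\<omega>. iexp (u * t i * ((T (t i * exp h) \<omega> - T (t i) \<omega>) / t i)) \<partial>M)"
      unfolding distr_scaled_increment[OF t0[of i], of h, symmetric] char_def
      by (subst integral_distr) auto
    also have "\<dots> = (\<integral>\<omega>. iexp (u * (T (t i * exp h) \<omega> - T (t i) \<omega>)) \<partial>M)"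
      using t0[of i] by (intro Bochner_Integration.integral_cong) auto
    also have "\<dots> = char (distr M borel (X (Suc i))) u"
      unfolding char_def X_def tS by (subst integral_distr) (auto simp: tS)
    finally show ?thesis ..
  qed
  show ?thesis
    using c unfolding tel by (simp add: prod.reindex Xi) (simp add: t_def)
qed

text \<open>The path tends to 0 at time 0, so \<open>T t\<close> is a limit of increments between
  positive times. The denominators start at 2 to keep the earlier time strictly below
  \<open>t\<close>.\<close>

lemma char_T:
  assumes t: "0 < t"
  shows "(\<lambda>m. char (distr M borel (\<lambda>\<omega>. T t \<omega> - T (t / real (Suc (Suc m))) \<omega>)) u)
    \<longlonglongrightarrow> char (distr M borel (T t)) u"
proof -
  define r where "r m = t / real (Suc (Suc m))" for m
  have r_pos: "0 < r m" for m using t by (simp add: r_def)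
  have [measurable]: "T t \<in> borel_measurable M" "T (r m) \<in> borel_measurable M" for m
    using t r_pos by (auto intro!: measurable_T)
  have at0: "filterlim r (at_right 0) sequentially"
    using LIMSEQ_Suc[OF LIMSEQ_Suc[OF lim_const_over_n[of t]]] t
    unfolding r_def[abs_def] by (auto intro!: tendsto_imp_filterlim_at_right)
  have "(\<lambda>m. \<integral>\<omega>. cis (u * (T t \<omega> - T (r m) \<omega>)) \<partial>M) \<longlonglongrightarrow> (\<integral>\<omega>. cis (u * (T t \<omega> - 0)) \<partial>M)"
  proof (rule integral_dominated_convergence[where w="\<lambda>_. 1"])
    show "AE \<omega> in M. (\<lambda>m. cis (u * (T t \<omega> - T (r m) \<omega>))) \<longlonglongrightarrow> cis (u * (T t \<omega> - 0))"
      using AE_regular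
    proof eventually_elim
      case (elim \<omega>)
      then have "(\<lambda>m. T (r m) \<omega>) \<longlonglongrightarrow> 0"
        using filterlim_compose[OF _ at0, of "path \<omega>"] unfolding regular_def by blast
      then show ?case by (intro tendsto_intros)
    qed
    show "(\<lambda>\<omega>. cis (u * (T t \<omega> - T (r m) \<omega>))) \<in> borel_measurable M" for m
      by measurable
  qed simp_all
  moreover have "char (distr M borel (\<lambda>\<omega>. T t \<omega> - T (r m) \<omega>)) u
      = (\<integral>\<omega>. cis (u * (T t \<omega> - T (r m) \<omega>)) \<partial>M)" for m
    unfolding char_def by (subst integral_distr) (auto simp: cis_conv_exp)
  moreover have "char (distr M borel (T t)) u = (\<integral>\<omega>. cis (u * (T t \<omega> - 0)) \<partial>M)"
    unfolding char_def by (subst integral_distr) (auto simp: cis_conv_exp)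
  ultimately show ?thesis by (simp only: r_def)
qed

end

section \<open>Comparison of two processes of the same rate\<close>

locale two_no_drift_ssa =
  P: no_drift_ssa M T \<theta> + P': no_drift_ssa N T' \<theta>
  for M :: "'a measure" and T :: "real \<Rightarrow> 'a \<Rightarrow> real"
    and N :: "'b measure" and T' :: "real \<Rightarrow> 'b \<Rightarrow> real" and \<theta> :: real
begin

text \<open>A shift of \<open>ln gap\<close> by \<gamma> is a factor \<open>exp \<gamma>\<close> of
  \<open>gap\<close>; almost sure positivity of the gap permits the passage between the two.\<close>

lemma char_gap_eq:
  assumes \<theta>: "0 < \<theta>" and law: "range_law M T = range_law N T'"
  obtains c where "0 < c" "\<And>v. P.char_gap v = P'.char_gap (c * v)"
proof -
  have "phase_prod P.log_gap_char (0 # as) = phase_prod P'.log_gap_char (0 # as)" for as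
    using P.integral_range_law[OF \<theta>, of as] P'.integral_range_law[OF \<theta>, of as] law
    by (intro limit_weight_cancel[OF _ \<theta>]) simp
  then have rel: "P.log_gap_char (real n * d) * P.log_gap_char (- d) ^ n
      = P'.log_gap_char (real n * d) * P'.log_gap_char (- d) ^ n" for n d
    by (simp only: phase_prod_down_steps[symmetric])
  obtain \<gamma> where \<gamma>: "\<And>b. P.log_gap_char b = cis (\<gamma> * b) * P'.log_gap_char b"
    by (rule shift_of_product_relation[OF P.isCont_log_gap_char P'.isCont_log_gap_char
          P.log_gap_char_0 P'.log_gap_char_0 P.log_gap_char_minus P'.log_gap_char_minus rel]) blast
  have eq: "distr M borel (\<lambda>\<omega>. ln (P.gap \<omega>)) = distr N borel (\<lambda>\<omega>. ln (P'.gap \<omega>) + \<gamma>)"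
  proof (rule Levy_uniqueness)
    show "char (distr M borel (\<lambda>\<omega>. ln (P.gap \<omega>))) = char (distr N borel (\<lambda>\<omega>. ln (P'.gap \<omega>) + \<gamma>))"
    proof
      fix b
      have "char (distr N borel (\<lambda>\<omega>. ln (P'.gap \<omega>) + \<gamma>)) b = (\<integral>\<omega>. cis (\<gamma> * b) * cis (b * ln (P'.gap \<omega>)) \<partial>N)"
      proof -
        have "char (distr N borel (\<lambda>\<omega>. ln (P'.gap \<omega>) + \<gamma>)) b = (\<integral>\<omega>. cis (b * (ln (P'.gap \<omega>) + \<gamma>)) \<partial>N)"
          unfolding char_def by (subst integral_distr) (auto simp: cis_conv_exp)
        also have "\<dots> = (\<integral>\<omega>. cis (\<gamma> * b) * cis (b * ln (P'.gap \<omega>)) \<partial>N)"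
          unfolding cis_mult by (simp add: algebra_simps)
        finally show ?thesis .
      qed
      also have "\<dots> = cis (\<gamma> * b) * P'.log_gap_char b"
        unfolding P'.log_gap_char_def by simp
      finally show "char (distr M borel (\<lambda>\<omega>. ln (P.gap \<omega>))) b
        = char (distr N borel (\<lambda>\<omega>. ln (P'.gap \<omega>) + \<gamma>)) b"
        by (simp add: P.char_log_gap \<gamma>)
    qed
  qed (auto intro!: P.real_distribution_distr P'.real_distribution_distr)
  have "P.char_gap v = P'.char_gap (exp \<gamma> * v)" for v
  proof -
    have "P.char_gap v = (\<integral>\<omega>. cis (v * exp (ln (P.gap \<omega>))) \<partial>M)"
      unfolding P.char_gap_def
    proof (rule Bochner_Integration.integral_cong_AE)
      show "AE \<omega> in M. cis (v * P.gap \<omega>) = cis (v * exp (ln (P.gap \<omega>)))"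
        using P.AE_gap[OF \<theta>] by eventually_elim simp
    qed measurable
    also have "\<dots> = (\<integral>x. cis (v * exp x) \<partial>distr M borel (\<lambda>\<omega>. ln (P.gap \<omega>)))"
      by (subst integral_distr) auto
    also have "\<dots> = (\<integral>\<omega>. cis (v * exp (ln (P'.gap \<omega>) + \<gamma>)) \<partial>N)"
      unfolding eq by (subst integral_distr) auto
    also have "\<dots> = (\<integral>\<omega>. cis (exp \<gamma> * v * P'.gap \<omega>) \<partial>N)"
    proof (rule Bochner_Integration.integral_cong_AE)
      show "AE \<omega> in N. cis (v * exp (ln (P'.gap \<omega>) + \<gamma>)) = cis (exp \<gamma> * v * P'.gap \<omega>)"
        using P'.AE_gap[OF \<theta>] by eventually_elim (simp add: exp_add algebra_simps)
    qed measurable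
    finally show ?thesis unfolding P'.char_gap_def .
  qed
  then show ?thesis by (intro that[of "exp \<gamma>"]) auto
qed

context
  fixes c :: real
  assumes \<theta>: "0 < \<theta>" and c: "0 < c" and eq: "\<And>v. P.char_gap v = P'.char_gap (c * v)"
begin

text \<open>The atoms at 0 have equal mass, so only the nonzero parts differ, and their mass is at
  most \<open>\<theta> * h\<close>. This factor \<open>h\<close> compensates for the number of
  cells, which is of order \<open>1 / h\<close>; the other factor tends to 0.\<close>

lemma char_incr_law_dist:
  assumes h: "0 < h" and v: "\<bar>v\<bar> \<le> U"
  shows "norm (char (P.incr_law h) v - char (P'.incr_law h) (c * v))
    \<le> \<theta> * h * (P.val_dist U h + P'.val_dist (c * U) h)"
proof -
  let ?p = "1 - exp (- (\<theta> * h))"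
  have p: "0 \<le> ?p" "?p \<le> \<theta> * h" using \<theta> h exp_ge_add_one_self[of "- (\<theta> * h)"] by auto
  have 1: "norm (P.incr_char h v - P.char_gap v) \<le> P.val_dist U h"
    by (rule P.incr_char_dist[OF \<theta> h v])
  have 2: "norm (P'.incr_char h (c * v) - P'.char_gap (c * v)) \<le> P'.val_dist (c * U) h"
    using v c by (intro P'.incr_char_dist[OF \<theta> h]) (simp add: abs_mult)
  have "norm (P.incr_char h v - P'.incr_char h (c * v))
    = norm ((P.incr_char h v - P.char_gap v) - (P'.incr_char h (c * v) - P'.char_gap (c * v)))"
    by (simp add: eq)
  also have "\<dots> \<le> P.val_dist U h + P'.val_dist (c * U) h"
    using norm_triangle_ineq4 add_mono[OF 1 2] by (rule order_trans)
  finally have 3: "norm (P.incr_char h v - P'.incr_char h (c * v)) \<le> P.val_dist U h + P'.val_dist (c * U) h" .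
  have "char (P.incr_law h) v - char (P'.incr_law h) (c * v)
    = of_real ?p * (P.incr_char h v - P'.incr_char h (c * v))"
    unfolding P.char_incr_law[OF \<theta> h] P'.char_incr_law[OF \<theta> h] by (simp add: algebra_simps)
  then have "norm (char (P.incr_law h) v - char (P'.incr_law h) (c * v))
    = ?p * norm (P.incr_char h v - P'.incr_char h (c * v))"
    using p(1) by (simp add: norm_mult del: of_real_diff)
  also have "\<dots> \<le> \<theta> * h * (P.val_dist U h + P'.val_dist (c * U) h)"
    by (intro mult_mono p 3) (use \<theta> h in auto)
  finally show ?thesis .
qed

text \<open>All factors of the two products have modulus at most 1, so replacing them one at a time
  costs at most the sum of the single errors. Over \<open>Suc n\<close> cells this is
  \<open>\<theta> * l\<close> times a quantity tending to 0, whereas the difference itself does not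
  depend on \<open>n\<close>.\<close>

lemma char_increment_eq:
  assumes s: "0 < s" "s < t"
  shows "char (distr M borel (\<lambda>\<omega>. T t \<omega> - T s \<omega>)) u = char (distr N borel (\<lambda>\<omega>. T' t \<omega> - T' s \<omega>)) (c * u)"
    (is "?A = ?B")
proof -
  define l where "l = ln (t / s)"
  have l: "0 < l" using s by (simp add: l_def)
  define h where "h n = l / real (Suc n)" for n
  have h: "h \<longlonglongrightarrow> 0" "\<And>n. 0 < h n"
    unfolding h_def using LIMSEQ_Suc[OF lim_const_over_n[of l]] l by auto
  \<comment> \<open>The left ends of the cells do not exceed \<open>t\<close>, so \<open>U\<close>
    bounds the frequencies of all cells for every \<open>n\<close>.\<close>
  define U where "U = \<bar>u\<bar> * t"
  have U: "0 \<le> U" using s by (simp add: U_def)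
  have bound: "norm (?A - ?B) \<le> \<theta> * l * (P.val_dist U (h n) + P'.val_dist (c * U) (h n))" for n
  proof -
    interpret I: real_distribution "P.incr_law (h n)" by (rule P.real_distribution_incr_law)
    interpret I': real_distribution "P'.incr_law (h n)" by (rule P'.real_distribution_incr_law)
    have hn: "h n * real (Suc n) = l" unfolding h_def by (simp del: of_nat_Suc)
    then have t: "t = s * exp (h n * real (Suc n))"
      using s by (simp only:) (simp add: l_def)
    let ?v = "\<lambda>i. u * (s * exp (h n * real i))"
    have A: "?A = (\<Prod>i<Suc n. char (P.incr_law (h n)) (?v i))"
      by (subst t) (rule P.char_increment[OF s(1) h(2)])
    have B: "?B = (\<Prod>i<Suc n. char (P'.incr_law (h n)) (c * ?v i))"
      by (subst t) (simp only: P'.char_increment[OF s(1) h(2)] mult.assoc)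
    have "norm (?A - ?B) \<le> (\<Sum>i<Suc n. norm (char (P.incr_law (h n)) (?v i) - char (P'.incr_law (h n)) (c * ?v i)))"
      unfolding A B by (intro norm_prod_diff I.cmod_char_le_1 I'.cmod_char_le_1)
    also have "\<dots> \<le> (\<Sum>i<Suc n. \<theta> * h n * (P.val_dist U (h n) + P'.val_dist (c * U) (h n)))"
    proof (intro sum_mono char_incr_law_dist h)
      fix i assume "i \<in> {..<Suc n}"
      then have "h n * real i \<le> h n * real (Suc n)" using h(2)[of n] by (intro mult_left_mono) auto
      then have "s * exp (h n * real i) \<le> t" using s by (subst t) simp
      then show "\<bar>?v i\<bar> \<le> U"
        using s unfolding U_def by (simp add: abs_mult mult_left_mono)
    qed
    also have "\<dots> = \<theta> * (h n * real (Suc n)) * (P.val_dist U (h n) + P'.val_dist (c * U) (h n))"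
      by (simp del: of_nat_Suc)
    finally show ?thesis unfolding hn .
  qed
  have "(\<lambda>n. \<theta> * l * (P.val_dist U (h n) + P'.val_dist (c * U) (h n))) \<longlonglongrightarrow> \<theta> * l * (0 + 0)"
    using U c by (intro tendsto_intros P.val_dist_tendsto P'.val_dist_tendsto \<theta> h) auto
  then have "norm (?A - ?B) \<le> \<theta> * l * (0 + 0)"
    by (rule LIMSEQ_le_const) (use bound in blast)
  then show ?thesis by simp
qed

lemma char_T_eq:
  assumes t: "0 < t"
  shows "char (distr M borel (T t)) u = char (distr N borel (T' t)) (c * u)"
proof (rule LIMSEQ_unique[OF P.char_T[OF t]])
  have "char (distr M borel (\<lambda>\<omega>. T t \<omega> - T (t / real (Suc (Suc m))) \<omega>)) u
    = char (distr N borel (\<lambda>\<omega>. T' t \<omega> - T' (t / real (Suc (Suc m))) \<omega>)) (c * u)" for m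
    using t by (intro char_increment_eq) (simp_all add: divide_less_eq add_pos_nonneg algebra_simps)
  then show "(\<lambda>m. char (distr M borel (\<lambda>\<omega>. T t \<omega> - T (t / real (Suc (Suc m))) \<omega>)) u)
      \<longlonglongrightarrow> char (distr N borel (T' t)) (c * u)"
    using P'.char_T[OF t, of "c * u"] by simp
qed

lemma distr_eq_if_char_eq:
  assumes X[measurable]: "X \<in> borel_measurable M" and Y[measurable]: "Y \<in> borel_measurable N"
    and "\<And>u. char (distr M borel X) u = char (distr N borel Y) (c * u)"
  shows "distr M borel X = distr N borel (\<lambda>\<omega>. c * Y \<omega>)"
proof (rule Levy_uniqueness)
  show "char (distr M borel X) = char (distr N borel (\<lambda>\<omega>. c * Y \<omega>))"
  proof
    fix u
    have "char (distr N borel Y) (c * u) = char (distr N borel (\<lambda>\<omega>. c * Y \<omega>)) u"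
      unfolding char_def by (subst (1 2) integral_distr) (auto simp: algebra_simps)
    then show "char (distr M borel X) u = char (distr N borel (\<lambda>\<omega>. c * Y \<omega>)) u"
      using assms(3) by simp
  qed
qed (auto intro!: P.real_distribution_distr P'.real_distribution_distr)

text \<open>Independent increments with equal marginals have equal joint laws, and the values at the
  times in \<open>J\<close> are partial sums of increments, the one from time 0 included.\<close>

lemma same_fdd_scaled: "same_fdd M T N (\<lambda>s \<omega>. c * T' s \<omega>)"
  unfolding same_fdd_def
proof (intro allI impI)
  fix J :: "real set" assume J: "finite J \<and> J \<subseteq> {0<..}"
  show "distr M (Pi\<^sub>M J (\<lambda>_. borel)) (\<lambda>\<omega>. \<lambda>s\<in>J. T s \<omega>)
    = distr N (Pi\<^sub>M J (\<lambda>_. borel)) (\<lambda>\<omega>. \<lambda>s\<in>J. c * T' s \<omega>)"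
  proof (cases "J = {}")
    \<comment> \<open>The enumeration of times used otherwise starts with a first element; for empty
      \<open>J\<close> both laws are the same point mass.\<close>
    case True
    have "(\<lambda>_. undefined) \<in> space (Pi\<^sub>M {} (\<lambda>_. borel :: real measure))"
      by (simp add: space_PiM)
    from P.distr_const[OF this] P'.distr_const[OF this] True show ?thesis
      by (simp add: restrict_def)
  next
    case False
    define xs where "xs = sorted_list_of_set J"
    have xs: "set xs = J" "sorted_wrt (<) xs"
      using J by (auto simp: xs_def)
    define n where "n = length xs - 1"
    have len: "length xs = Suc n" using xs(1) False by (cases xs) (auto simp: n_def)
    define t where "t i = xs ! i" for i
    have tJ: "t i \<in> J" if "i \<le> n" for i
      unfolding t_def xs(1)[symmetric] using that len by (intro nth_mem) simp
    have tpos: "0 < t i" if "i \<le> n" for i using tJ[OF that] J by auto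
    have tmono: "strict_mono_on {..n} t"
      unfolding t_def strict_mono_on_def using xs(2) len by (auto intro: sorted_wrt_nth_less)
    have "\<exists>i\<le>n. t i = s" if "s \<in> J" for s
      using that len unfolding xs(1)[symmetric] t_def in_set_conv_nth by (auto simp: less_Suc_eq_le)
    then obtain idx where idx: "\<And>s. s \<in> J \<Longrightarrow> idx s \<le> n \<and> t (idx s) = s" by metis
    define X where "X i \<omega> = (if i = 0 then T (t 0) \<omega> else T (t i) \<omega> - T (t (i - 1)) \<omega>)" for i :: nat and \<omega>
    define Y where "Y i \<omega> = (if i = 0 then T' (t 0) \<omega> else T' (t i) \<omega> - T' (t (i - 1)) \<omega>)" for i :: nat and \<omega>
    have TX: "T (t i) \<in> borel_measurable M" and TY: "T' (t i) \<in> borel_measurable N" if "i \<le> n" for i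
      using tpos[OF that] P.measurable_T P'.measurable_T by auto
    have mX: "X i \<in> borel_measurable M" and mY: "Y i \<in> borel_measurable N" if "i \<le> n" for i
      using TX[of i] TX[of "i - 1"] TY[of i] TY[of "i - 1"] that
      unfolding X_def[abs_def] Y_def[abs_def] by (cases "i = 0"; simp)+
    have indX: "P.indep_vars (\<lambda>_. borel) X {..n}"
      using P.ssa tpos[of 0] tmono unfolding ssa1_def indep_increments_def X_def by simp
    have indY: "P'.indep_vars (\<lambda>_. borel) Y {..n}"
      using P'.ssa tpos[of 0] tmono unfolding ssa1_def indep_increments_def Y_def by simp
    have indcY: "P'.indep_vars (\<lambda>_. borel) (\<lambda>i \<omega>. c * Y i \<omega>) {..n}"
      by (rule P'.indep_vars_compose2[OF indY]) simp
    have marg: "distr M borel (X i) = distr N borel (\<lambda>\<omega>. c * Y i \<omega>)" if i: "i \<le> n" for i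
    proof (rule distr_eq_if_char_eq[OF mX[OF i] mY[OF i]])
      fix u
      show "char (distr M borel (X i)) u = char (distr N borel (Y i)) (c * u)"
      proof (cases "i = 0")
        case True
        then show ?thesis using char_T_eq[OF tpos[of 0], of u] by (simp add: X_def[abs_def] Y_def[abs_def])
      next
        case False
        have "t (i - 1) < t i"
          using tmono i False by (auto simp: strict_mono_on_def)
        then show ?thesis
          using char_increment_eq[OF tpos[of "i - 1"], of "t i" u] i False
          by (simp add: X_def[abs_def] Y_def[abs_def])
      qed
    qed
    have "distr M (Pi\<^sub>M {..n} (\<lambda>_. borel)) (\<lambda>\<omega>. \<lambda>i\<in>{..n}. X i \<omega>) = (\<Pi>\<^sub>M i\<in>{..n}. distr M borel (X i))"
      using indX mX by (subst (asm) P.indep_vars_iff_distr_eq_PiM') auto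
    also have "\<dots> = (\<Pi>\<^sub>M i\<in>{..n}. distr N borel (\<lambda>\<omega>. c * Y i \<omega>))"
      by (rule PiM_cong) (simp_all add: marg)
    also have "\<dots> = distr N (Pi\<^sub>M {..n} (\<lambda>_. borel)) (\<lambda>\<omega>. \<lambda>i\<in>{..n}. c * Y i \<omega>)"
      using indcY mY by (subst (asm) P'.indep_vars_iff_distr_eq_PiM') auto
    finally have joint: "distr M (Pi\<^sub>M {..n} (\<lambda>_. borel)) (\<lambda>\<omega>. \<lambda>i\<in>{..n}. X i \<omega>)
      = distr N (Pi\<^sub>M {..n} (\<lambda>_. borel)) (\<lambda>\<omega>. \<lambda>i\<in>{..n}. c * Y i \<omega>)" .
    define g where "g x = (\<lambda>s\<in>J. \<Sum>i\<le>idx s. x i)" for x :: "nat \<Rightarrow> real"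
    have g: "g \<in> measurable (Pi\<^sub>M {..n} (\<lambda>_. borel)) (Pi\<^sub>M J (\<lambda>_. borel))"
      unfolding g_def[abs_def]
    proof (rule measurable_restrict)
      fix s assume "s \<in> J"
      then have s: "idx s \<le> n" using idx by blast
      show "(\<lambda>x :: nat \<Rightarrow> real. \<Sum>i\<le>idx s. x i) \<in> measurable (Pi\<^sub>M {..n} (\<lambda>_. borel)) borel"
        by (rule borel_measurable_sum[where f="\<lambda>i x. x i"], rule measurable_component_singleton)
          (use s in auto)
    qed
    have tel: "(\<Sum>i\<le>k. if i = 0 then f 0 else f i - f (i - 1)) = f k" for k and f :: "nat \<Rightarrow> real"
      by (induction k) auto
    have gX: "g (\<lambda>i\<in>{..n}. X i \<omega>) = (\<lambda>s\<in>J. T s \<omega>)" for \<omega>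
      unfolding g_def
    proof (rule restrict_ext)
      fix s assume "s \<in> J"
      then have s: "idx s \<le> n" "t (idx s) = s" using idx by blast+
      then have "(\<Sum>i\<le>idx s. (\<lambda>i\<in>{..n}. X i \<omega>) i) = (\<Sum>i\<le>idx s. X i \<omega>)"
        by (intro sum.cong) auto
      also have "\<dots> = T s \<omega>"
        unfolding X_def using tel[of "\<lambda>i. T (t i) \<omega>" "idx s"] s(2) by simp
      finally show "(\<Sum>i\<le>idx s. (\<lambda>i\<in>{..n}. X i \<omega>) i) = T s \<omega>" .
    qed
    have gY: "g (\<lambda>i\<in>{..n}. c * Y i \<omega>) = (\<lambda>s\<in>J. c * T' s \<omega>)" for \<omega>
      unfolding g_def
    proof (rule restrict_ext)
      fix s assume "s \<in> J"
      then have s: "idx s \<le> n" "t (idx s) = s" using idx by blast+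
      then have "(\<Sum>i\<le>idx s. (\<lambda>i\<in>{..n}. c * Y i \<omega>) i) = (\<Sum>i\<le>idx s. c * Y i \<omega>)"
        by (intro sum.cong) auto
      also have "\<dots> = c * (\<Sum>i\<le>idx s. Y i \<omega>)"
        by (rule sum_distrib_left[symmetric])
      also have "(\<Sum>i\<le>idx s. Y i \<omega>) = T' s \<omega>"
        unfolding Y_def using tel[of "\<lambda>i. T' (t i) \<omega>" "idx s"] s(2) by simp
      finally show "(\<Sum>i\<le>idx s. (\<lambda>i\<in>{..n}. c * Y i \<omega>) i) = c * T' s \<omega>" .
    qed
    have "distr M (Pi\<^sub>M J (\<lambda>_. borel)) (\<lambda>\<omega>. \<lambda>s\<in>J. T s \<omega>)
      = distr (distr M (Pi\<^sub>M {..n} (\<lambda>_. borel)) (\<lambda>\<omega>. \<lambda>i\<in>{..n}. X i \<omega>)) (Pi\<^sub>M J (\<lambda>_. borel)) g"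
      by (subst distr_distr[OF g]) (auto intro!: measurable_restrict mX simp: comp_def gX)
    also have "\<dots> = distr N (Pi\<^sub>M J (\<lambda>_. borel)) (\<lambda>\<omega>. \<lambda>s\<in>J. c * T' s \<omega>)"
      unfolding joint
      by (subst distr_distr[OF g]) (auto intro!: measurable_restrict borel_measurable_times mY simp: comp_def gY)
    finally show ?thesis .
  qed
qed

end

text \<open>At rate 0 each value vanishes almost surely, and finitely many times share one null set,
  so both laws are point masses at 0.\<close>

lemma same_fdd_rate_0:
  assumes "\<theta> = 0"
  shows "same_fdd M T N T'"
  unfolding same_fdd_def
proof (intro allI impI)
  fix J :: "real set" assume J: "finite J \<and> J \<subseteq> {0<..}"
  let ?P = "Pi\<^sub>M J (\<lambda>_. borel) :: (real \<Rightarrow> real) measure"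
  have zero: "(\<lambda>s\<in>J. 0) \<in> space ?P" by (simp add: space_PiM)
  have J0: "0 < s" if "s \<in> J" for s using J that by auto
  have "distr M ?P (\<lambda>\<omega>. \<lambda>s\<in>J. T s \<omega>) = distr M ?P (\<lambda>\<omega>. \<lambda>s\<in>J. 0)"
  proof (rule distr_cong_AE)
    have "AE \<omega> in M. \<forall>s\<in>J. T s \<omega> = 0"
      using J P.T_eq_0[OF assms] J0 by (intro AE_finite_allI) auto
    then show "AE \<omega> in M. (\<lambda>s\<in>J. T s \<omega>) = (\<lambda>s\<in>J. 0)"
      by eventually_elim (simp cong: restrict_cong)
  qed (auto intro!: measurable_restrict P.measurable_T J0)
  also have "\<dots> = return ?P (\<lambda>s\<in>J. 0)" by (rule P.distr_const[OF zero])
  also have "\<dots> = distr N ?P (\<lambda>\<omega>. \<lambda>s\<in>J. 0)" by (rule P'.distr_const[OF zero, symmetric])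
  also have "\<dots> = distr N ?P (\<lambda>\<omega>. \<lambda>s\<in>J. T' s \<omega>)"
  proof (rule distr_cong_AE)
    have "AE \<omega> in N. \<forall>s\<in>J. T' s \<omega> = 0"
      using J P'.T_eq_0[OF assms] J0 by (intro AE_finite_allI) auto
    then show "AE \<omega> in N. (\<lambda>s\<in>J. 0) = (\<lambda>s\<in>J. T' s \<omega>)"
      by eventually_elim (simp cong: restrict_cong)
  qed (auto intro!: measurable_restrict P'.measurable_T J0)
  finally show "distr M ?P (\<lambda>\<omega>. \<lambda>s\<in>J. T s \<omega>) = distr N ?P (\<lambda>\<omega>. \<lambda>s\<in>J. T' s \<omega>)" .
qed

end

theorem theorem6p1:
  fixes M :: "'a measure" and N :: "'b measure"
    and T :: "real \<Rightarrow> 'a \<Rightarrow> real" and T' :: "real \<Rightarrow> 'b \<Rightarrow> real"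
    and \<theta> :: real
  assumes "0 \<le> \<theta>"
    and "ssa1 M T" and "nondecreasing_process M T" and "no_drift M T" and "finite_rate M T \<theta>"
    and "ssa1 N T'" and "nondecreasing_process N T'" and "no_drift N T'" and "finite_rate N T' \<theta>"
    and "range_law M T = range_law N T'"
  shows "\<exists>c>0. same_fdd M T N (\<lambda>s \<omega>. c * T' s \<omega>)"
proof -
  interpret PM: prob_space M using assms(2) by (simp add: ssa1_def)
  interpret PN: prob_space N using assms(6) by (simp add: ssa1_def)
  interpret two_no_drift_ssa M T N T' \<theta>
    by unfold_locales (use assms in auto)
  show ?thesis
  proof (cases "\<theta> = 0")
    case True
    from same_fdd_rate_0[OF this] show ?thesis by (intro exI[of _ 1]) simp
  next
    case False
    with assms(1) have "0 < \<theta>" by simp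
    then obtain c where "0 < c" "\<And>v. P.char_gap v = P'.char_gap (c * v)"
      using char_gap_eq assms(10) by blast
    with \<open>0 < \<theta>\<close> show ?thesis using same_fdd_scaled by blast
  qed
qed

end
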